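(* Let $X$ be an infinite-dimensional complex Banach space, $T\in L(X)$, $T^*$ its dual, and $\Delta_e(T)=\sigma(T)\setminus\sigma_e(T)$. The following are equivalent: (i) $T\in(B_e)$; (ii) for every $\lambda\in\Delta_e(T)$, $p:=p(T-\lambda I)$ is finite and $H_0((T\oplus T^* )-\lambda I)=\mathcal N(((T\oplus T^* )-\lambda I)^p)$; (iii) $H_0((T\oplus T^* )-\lambda I)$ is finite-dimensional for every $\lambda\in\Delta_e(T)$; (iv) $H_0((T\oplus T^* )-\lambda I)$ is closed for every $\lambda\in\Delta_e(T)$; (v) $K((T\oplus T^* )-\lambda I)$ has finite codimension in $X\oplus X^*$ for every $\lambda\in\Delta_e(T)$.
   Context: $T\oplus T^*$ acts on $X\oplus X^*$. For an operator $S$ on a Banach space $Y$: the quasinilpotent part is $H_0(S)=\{x\in Y:\lim_{n\to\infty}\|S^nx\|^{1/n}=0\}$; the analytic core $K(S)$ is the set of $x\in Y$ for which there exist $c>0$ and a sequence $(x_n)$ in $Y$ with $x_0=x$, $Sx_{n+1}=x_n$ and $\|x_n\|\le c^n\|x\|$ for all $n$. $\alpha(S)=\dim\mathcal N(S)$, $\beta(S)=\operatorname{codim}\mathcal R(S)$, ascent $p(S)=\inf\{n:\mathcal N(S^n)=\mathcal N(S^{n+1})\}$, descent $q(S)=\inf\{n:\mathcal R(S^n)=\mathcal R(S^{n+1})\}$. $S$ Fredholm: $\mathcal R(S)$ closed, $\alpha,\beta<\infty$. $\sigma_e(T)$: set of $\lambda$ with $T-\lambda I$ not Fredholm. $\Pi^0(T)$: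 $\lambda\in\sigma(T)$ with $p(T-\lambda I),q(T-\lambda I)<\infty$ and $\alpha(T-\lambda I)<\infty$. $T\in(B_e)$ means $\Delta_e(T)=\Pi^0(T)$. *)

theory Defs
  imports "HOL-Analysis.Analysis"
begin

class cbanach = banach +
  fixes cscale :: "complex \<Rightarrow> 'a \<Rightarrow> 'a"
  assumes cscale_of_real: "cscale (of_real r) x = scaleR r x"
    and cscale_add_right: "cscale a (x + y) = cscale a x + cscale a y"
    and cscale_add_left: "cscale (a + b) x = cscale a x + cscale b x"
    and cscale_mult: "cscale a (cscale b x) = cscale (a * b) x"
    and norm_cscale: "norm (cscale a x) = cmod a * norm x"

definition cspan :: "(complex \<Rightarrow> 'b::comm_monoid_add \<Rightarrow> 'b) \<Rightarrow> 'b set \<Rightarrow> 'b set"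
  where "cspan sm A = {y. \<exists>F c. finite F \<and> F \<subseteq> A \<and> y = (\<Sum>v\<in>F. sm (c v) v)}"

definition fin_dim :: "(complex \<Rightarrow> 'b::comm_monoid_add \<Rightarrow> 'b) \<Rightarrow> 'b set \<Rightarrow> bool"
  where "fin_dim sm A \<longleftrightarrow> (\<exists>F. finite F \<and> F \<subseteq> A \<and> A \<subseteq> cspan sm F)"

definition fin_codim :: "(complex \<Rightarrow> 'b::comm_monoid_add \<Rightarrow> 'b) \<Rightarrow> 'b set \<Rightarrow> 'b set \<Rightarrow> bool"
  where "fin_codim sm V A \<longleftrightarrow> (\<exists>F. finite F \<and> F \<subseteq> V \<and> V \<subseteq> cspan sm (A \<union> F))"

definition kernel_on :: "'b set \<Rightarrow> ('b \<Rightarrow> 'b::zero) \<Rightarrow> 'b set"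
  where "kernel_on V S = {x \<in> V. S x = 0}"

definition range_on :: "'b set \<Rightarrow> ('b \<Rightarrow> 'b) \<Rightarrow> 'b set"
  where "range_on V S = S ` V"

definition H0 :: "'b set \<Rightarrow> ('b \<Rightarrow> 'b::real_normed_vector) \<Rightarrow> 'b set"
  where "H0 V S = {x \<in> V. (\<lambda>n. root n (norm ((S ^^ n) x))) \<longlonglongrightarrow> 0}"

definition Kcore :: "'b set \<Rightarrow> ('b \<Rightarrow> 'b::real_normed_vector) \<Rightarrow> 'b set"
  where "Kcore V S = {x \<in> V. \<exists>c>0. \<exists>xs. xs 0 = x \<and>
            (\<forall>n. xs n \<in> V \<and> S (xs (Suc n)) = xs n \<and> norm (xs n) \<le> c ^ n * norm x)}"

definition clinear_op :: "('a::cbanach \<Rightarrow> 'a) \<Rightarrow> bool"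
  where "clinear_op A \<longleftrightarrow> bounded_linear A \<and> (\<forall>c x. A (cscale c x) = cscale c (A x))"

definition shift :: "('a::cbanach \<Rightarrow>\<^sub>L 'a) \<Rightarrow> complex \<Rightarrow> 'a \<Rightarrow> 'a"
  where "shift T \<mu> = (\<lambda>x. blinfun_apply T x - cscale \<mu> x)"

definition invertible_op :: "('a::cbanach \<Rightarrow> 'a) \<Rightarrow> bool"
  where "invertible_op A \<longleftrightarrow> (\<exists>B. clinear_op B \<and> B \<circ> A = id \<and> A \<circ> B = id)"

definition spectrum :: "('a::cbanach \<Rightarrow>\<^sub>L 'a) \<Rightarrow> complex set"
  where "spectrum T = {\<mu>. \<not> invertible_op (shift T \<mu>)}"

definition fredholm :: "('a::cbanach \<Rightarrow> 'a) \<Rightarrow> bool"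
  where "fredholm A \<longleftrightarrow> closed (range A) \<and> fin_dim cscale (kernel_on UNIV A)
                        \<and> fin_codim cscale UNIV (range A)"

definition ess_spectrum :: "('a::cbanach \<Rightarrow>\<^sub>L 'a) \<Rightarrow> complex set"
  where "ess_spectrum T = {\<mu>. \<not> fredholm (shift T \<mu>)}"

definition Delta_e :: "('a::cbanach \<Rightarrow>\<^sub>L 'a) \<Rightarrow> complex set"
  where "Delta_e T = spectrum T - ess_spectrum T"

definition finite_ascent :: "('a::cbanach \<Rightarrow> 'a) \<Rightarrow> bool"
  where "finite_ascent A \<longleftrightarrow> (\<exists>n. kernel_on UNIV (A ^^ n) = kernel_on UNIV (A ^^ Suc n))"

definition ascent :: "('a::cbanach \<Rightarrow> 'a) \<Rightarrow> nat"
  where "ascent A = (LEAST n. kernel_on UNIV (A ^^ n) = kernel_on UNIV (A ^^ Suc n))"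

definition finite_descent :: "('a::cbanach \<Rightarrow> 'a) \<Rightarrow> bool"
  where "finite_descent A \<longleftrightarrow> (\<exists>n. range (A ^^ n) = range (A ^^ Suc n))"

definition Pi0 :: "('a::cbanach \<Rightarrow>\<^sub>L 'a) \<Rightarrow> complex set"
  where "Pi0 T = {\<mu> \<in> spectrum T. finite_ascent (shift T \<mu>) \<and> finite_descent (shift T \<mu>)
                   \<and> fin_dim cscale (kernel_on UNIV (shift T \<mu>))}"

definition class_Be :: "('a::cbanach \<Rightarrow>\<^sub>L 'a) \<Rightarrow> bool"
  where "class_Be T \<longleftrightarrow> Delta_e T = Pi0 T"

text \<open>"X*": continuous complex-linear functionals, as a (closed) subset of the
real bounded linear maps "X to complex".\<close>
definition dual_space :: "('a::cbanach \<Rightarrow>\<^sub>L complex) set"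
  where "dual_space = {f. \<forall>c x. blinfun_apply f (cscale c x) = c * blinfun_apply f x}"

definition dual_scale :: "complex \<Rightarrow> ('a::cbanach \<Rightarrow>\<^sub>L complex) \<Rightarrow> ('a \<Rightarrow>\<^sub>L complex)"
  where "dual_scale c f = Blinfun (\<lambda>x. c * blinfun_apply f x)"

definition dual_op :: "('a::cbanach \<Rightarrow>\<^sub>L 'a) \<Rightarrow> ('a \<Rightarrow>\<^sub>L complex) \<Rightarrow> ('a \<Rightarrow>\<^sub>L complex)"
  where "dual_op T f = f o\<^sub>L T"

definition dsum_space :: "('a::cbanach \<times> ('a \<Rightarrow>\<^sub>L complex)) set"
  where "dsum_space = UNIV \<times> dual_space"

definition dsum_scale :: "complex \<Rightarrow> 'a::cbanach \<times> ('a \<Rightarrow>\<^sub>L complex) \<Rightarrow> 'a \<times> ('a \<Rightarrow>\<^sub>L complex)"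
  where "dsum_scale c y = (cscale c (fst y), dual_scale c (snd y))"

definition dsum_shift :: "('a::cbanach \<Rightarrow>\<^sub>L 'a) \<Rightarrow> complex
      \<Rightarrow> 'a \<times> ('a \<Rightarrow>\<^sub>L complex) \<Rightarrow> 'a \<times> ('a \<Rightarrow>\<^sub>L complex)"
  where "dsum_shift T \<mu> y = (blinfun_apply T (fst y), dual_op T (snd y)) - dsum_scale \<mu> y"

end

theory Submission
  imports Defs
begin

text \<open>
  Write \<open>A = T - \<mu>\<close> for \<open>\<mu>\<close> in \<open>\<Delta>\<^sub>e(T)\<close>. A point with finite ascent, descent and nullity is
  Fredholm, so \<open>T \<in> (B\<^sub>e)\<close> says that every such \<open>A\<close> has finite ascent and descent; each of the
  other conditions is shown to be equivalent to this for \<open>\<mu>\<close> separately.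

  If ascent and descent are finite, \<open>X = N(A\<^sup>n) \<oplus> R(A\<^sup>n)\<close> with \<open>A\<close> invertible on \<open>R(A\<^sup>n)\<close>, which
  determines \<open>H\<^sub>0\<close> and \<open>K\<close> of \<open>A \<oplus> A\<^sup>*\<close>. Conversely, if \<open>H\<^sub>0(S)\<close> is closed and the ranges of the powers of
  \<open>S\<close> are closed, then \<open>S\<close> maps \<open>M = H\<^sub>0(S) \<inter> \<Inter>\<^sub>n R(S\<^sup>n)\<close> onto itself and is quasinilpotent on it,
  which forces \<open>M = 0\<close>; as \<open>N(S)\<close> is finite-dimensional, \<open>N(S) \<inter> R(S\<^sup>n) = 0\<close> for large \<open>n\<close>, i.e. \<open>S\<close> has
  finite ascent. This is applied to \<open>A\<close> and to \<open>A\<^sup>*\<close>, whose finite ascent is the finite descent of \<open>A\<close>. If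
  \<open>K(A \<oplus> A\<^sup>*)\<close> has finite codimension, the decreasing ranges of the powers of \<open>A\<close> and \<open>A\<^sup>*\<close>, all of which
  contain the corresponding component of \<open>K\<close>, become stationary.

  Dimension arguments are carried out over the reals, where finite (co)dimension means the same for
  complex subspaces.
\<close>

section \<open>The Hahn--Banach theorem\<close>

definition sublinear :: "('a::real_vector \<Rightarrow> real) \<Rightarrow> bool"
  where "sublinear p \<longleftrightarrow> (\<forall>x y. p (x + y) \<le> p x + p y) \<and> (\<forall>c x. 0 \<le> c \<longrightarrow> p (c *\<^sub>R x) = c * p x)"

lemma sublinear_add: "sublinear p \<Longrightarrow> p (x + y) \<le> p x + p y"
  and sublinear_scale: "sublinear p \<Longrightarrow> 0 \<le> c \<Longrightarrow> p (c *\<^sub>R x) = c * p x"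
  by (auto simp: sublinear_def)

lemma sublinear_zero: "sublinear p \<Longrightarrow> p 0 = 0"
  using sublinear_scale[of p 0 0] by simp

lemma sublinear_minus: "sublinear p \<Longrightarrow> - p (- x) \<le> p x"
  using sublinear_add[of p x "- x"] sublinear_zero[of p] by simp

lemma Inf_le_nonneg_scale:
  fixes A B :: "real set"
  assumes "B \<noteq> {}" "bdd_below A" "0 < c" and "\<And>b. b \<in> B \<Longrightarrow> \<exists>a\<in>A. a \<le> c * b"
  shows "Inf A \<le> c * Inf B"
proof -
  have "Inf A / c \<le> b" if "b \<in> B" for b
  proof -
    obtain a where "a \<in> A" "a \<le> c * b" using assms(4)[OF \<open>b \<in> B\<close>] by blast
    then have "Inf A \<le> c * b" using cInf_lower[OF _ assms(2)] by force
    then show ?thesis using assms(3) by (simp add: divide_le_eq mult.commute)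
  qed
  then have "Inf A / c \<le> Inf B" using assms(1) by (intro cInf_greatest)
  then show ?thesis using assms(3) by (simp add: divide_le_eq mult.commute)
qed

text \<open>The functionals constructed below are infima of sets \<open>G x\<close> of candidate
  values. If candidates can be added and scaled at the cost of at most decreasing them, these
  properties pass to the infima. A candidate at \<open>- x\<close> bounds those at \<open>x\<close>
  from below, because candidates at \<open>0\<close> are nonnegative.\<close>

lemma sublinear_Inf:
  fixes G :: "'a::real_vector \<Rightarrow> real set"
  assumes ne: "\<And>x. G x \<noteq> {}"
    and pos: "\<And>a. a \<in> G 0 \<Longrightarrow> 0 \<le> a"
    and add: "\<And>x y a b. a \<in> G x \<Longrightarrow> b \<in> G y \<Longrightarrow> \<exists>c\<in>G (x + y). c \<le> a + b"
    and scale: "\<And>x a c. a \<in> G x \<Longrightarrow> 0 < c \<Longrightarrow> \<exists>b\<in>G (c *\<^sub>R x). b \<le> c * a"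
  shows "sublinear (\<lambda>x. Inf (G x))" and "bdd_below (G x)"
proof -
  have bdd: "bdd_below (G x)" for x
  proof -
    obtain b where b: "b \<in> G (- x)" using ne by blast
    have "- b \<le> a" if "a \<in> G x" for a
      using add[OF that b] pos by force
    then show ?thesis by (auto simp: bdd_below_def)
  qed
  then show "bdd_below (G x)" .
  have sub: "Inf (G (x + y)) \<le> Inf (G x) + Inf (G y)" for x y
  proof -
    have "Inf (G (x + y)) - a \<le> b" if a: "a \<in> G x" and b: "b \<in> G y" for a b
      using add[OF a b] cInf_lower[OF _ bdd[of "x + y"]] by force
    then have "Inf (G (x + y)) - a \<le> Inf (G y)" if "a \<in> G x" for a
      using ne that by (meson cInf_greatest)
    then have "Inf (G (x + y)) - Inf (G y) \<le> a" if "a \<in> G x" for a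
      using that by (simp add: algebra_simps)
    then have "Inf (G (x + y)) - Inf (G y) \<le> Inf (G x)"
      using ne by (meson cInf_greatest)
    then show ?thesis by simp
  qed
  have le: "Inf (G (c *\<^sub>R x)) \<le> c * Inf (G x)" if "0 < c" for c x
    by (rule Inf_le_nonneg_scale) (use ne bdd scale that in auto)
  have ge: "c * Inf (G x) \<le> Inf (G (c *\<^sub>R x))" if "0 < c" for c x
    using le[of "inverse c" "c *\<^sub>R x"] that by (simp add: field_simps)
  \<comment> \<open>Homogeneity with factor 2 reads \<open>Inf (G 0) = 2 * Inf (G 0)\<close>. This
    settles the factor 0, which \<open>scale\<close> leaves out.\<close>
  have zero: "Inf (G 0) = 0"
    using le[of 2 0] ge[of 2 0] by simp
  show "sublinear (\<lambda>x. Inf (G x))"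
    unfolding sublinear_def using sub le ge zero
    by (metis antisym mult_zero_left order_le_less scaleR_zero_left)
qed

text \<open>\<open>q z\<close> is the infimum over \<open>t >= 0\<close> of
  \<open>p (z + t y) - t * p y\<close>. The value \<open>t = 0\<close> gives \<open>q <= p\<close>;
  at \<open>z = - y\<close> the value \<open>t = 1\<close> gives the last claim. A linear functional
  below \<open>q\<close> is then at least \<open>p y\<close> at \<open>y\<close>.\<close>

lemma sublinear_decrease:
  assumes p: "sublinear p"
  obtains q where "sublinear q" "q \<le> p" "q (- y) \<le> - p y"
proof -
  define G where "G z = {p (z + t *\<^sub>R y) - t * p y | t. 0 \<le> t}" for z
  define q where "q = (\<lambda>z. Inf (G z))"
  have G: "p (z + t *\<^sub>R y) - t * p y \<in> G z" if "0 \<le> t" for z t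
    using that by (auto simp: G_def)
  have prems: "G x \<noteq> {}" "a \<in> G 0 \<Longrightarrow> 0 \<le> a"
    "a \<in> G x \<Longrightarrow> b \<in> G z \<Longrightarrow> \<exists>c\<in>G (x + z). c \<le> a + b"
    "a \<in> G x \<Longrightarrow> 0 < c \<Longrightarrow> \<exists>b\<in>G (c *\<^sub>R x). b \<le> c * a" for x z a b c
  proof -
    show "G x \<noteq> {}" using G[of 0] by blast
    show "0 \<le> a" if "a \<in> G 0"
      using that sublinear_scale[OF p] by (auto simp: G_def)
    show "\<exists>c\<in>G (x + z). c \<le> a + b" if ab: "a \<in> G x" "b \<in> G z"
    proof -
      obtain s t where st: "0 \<le> s" "0 \<le> t" "a = p (x + s *\<^sub>R y) - s * p y" "b = p (z + t *\<^sub>R y) - t * p y"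
        using ab by (auto simp: G_def)
      have "p (x + z + (s + t) *\<^sub>R y) \<le> p (x + s *\<^sub>R y) + p (z + t *\<^sub>R y)"
        using sublinear_add[OF p, of "x + s *\<^sub>R y" "z + t *\<^sub>R y"] by (simp add: algebra_simps)
      then have "p (x + z + (s + t) *\<^sub>R y) - (s + t) * p y \<le> a + b"
        using st by (simp add: algebra_simps)
      then show ?thesis using G[of "s + t" "x + z"] st by (meson add_nonneg_nonneg)
    qed
    show "\<exists>b\<in>G (c *\<^sub>R x). b \<le> c * a" if ab: "a \<in> G x" "0 < c"
    proof -
      obtain t where t: "0 \<le> t" "a = p (x + t *\<^sub>R y) - t * p y"
        using ab by (auto simp: G_def)
      have "p (c *\<^sub>R x + (c * t) *\<^sub>R y) - (c * t) * p y = c * a"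
        using sublinear_scale[OF p, of c "x + t *\<^sub>R y"] ab t(1) unfolding t(2) by (simp add: algebra_simps)
      then show ?thesis using G[of "c * t" "c *\<^sub>R x"] t that by force
    qed
  qed
  have "sublinear q" unfolding q_def using prems by (rule sublinear_Inf)
  moreover have bdd: "bdd_below (G x)" for x using prems by (rule sublinear_Inf(2))
  have low: "q z \<le> p (z + t *\<^sub>R y) - t * p y" if "0 \<le> t" for z t
    unfolding q_def using cInf_lower[OF G[OF that] bdd] .
  have "q \<le> p" using low[of 0] by (simp add: le_fun_def)
  moreover have "q (- y) \<le> - p y" using low[of 1 "- y"] sublinear_zero[OF p] by simp
  ultimately show ?thesis using that by blast
qed

text \<open>A minimal sublinear functional below \<^term>\<open>p\<close> is linear: otherwise the previous lemma would
  decrease it further.\<close>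

theorem Hahn_Banach_sublinear:
  fixes p :: "'a::real_vector \<Rightarrow> real"
  assumes p: "sublinear p"
  obtains f where "linear f" "\<And>x. f x \<le> p x"
proof -
  define A where "A = {q. sublinear q \<and> q \<le> p}"
  have "\<exists>m\<in>A. \<forall>a\<in>A. a \<le> m \<longrightarrow> a = m"
  proof (rule predicate_Zorn[where P = "\<lambda>a b. b \<le> a"])
    show "partial_order_on A (relation_of (\<lambda>a b. b \<le> a) A)"
      by (rule partial_order_on_relation_ofI) auto
    fix C assume C: "C \<in> Chains (relation_of (\<lambda>a b. b \<le> a) A)"
    show "\<exists>u\<in>A. \<forall>a\<in>C. u \<le> a"
    proof (cases "C = {}")
      case True then show ?thesis using p by (auto simp: A_def)
    next
      case False
      have CA: "q \<in> C \<Longrightarrow> sublinear q \<and> q \<le> p" for q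
        using C by (auto simp: Chains_def relation_of_def A_def)
      have tot: "q \<in> C \<Longrightarrow> r \<in> C \<Longrightarrow> q \<le> r \<or> r \<le> q" for q r
        using C by (auto simp: Chains_def relation_of_def)
      \<comment> \<open>The lower bound of a chain is its pointwise infimum. Two candidates may stem
        from different members of the chain, but the smaller member serves at both points.\<close>
      define G where "G x = (\<lambda>q. q x) ` C" for x
      have prems: "G x \<noteq> {}" "a \<in> G 0 \<Longrightarrow> 0 \<le> a"
        "a \<in> G x \<Longrightarrow> b \<in> G z \<Longrightarrow> \<exists>c\<in>G (x + z). c \<le> a + b"
        "a \<in> G x \<Longrightarrow> 0 < c \<Longrightarrow> \<exists>b\<in>G (c *\<^sub>R x). b \<le> c * a" for x z a b c
      proof -
        show "G x \<noteq> {}" using False by (simp add: G_def)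
        show "0 \<le> a" if "a \<in> G 0" using that CA sublinear_zero by (force simp: G_def)
        show "\<exists>c\<in>G (x + z). c \<le> a + b" if ab: "a \<in> G x" "b \<in> G z"
        proof -
          obtain q r where qr: "q \<in> C" "r \<in> C" "a = q x" "b = r z"
            using ab by (auto simp: G_def)
          then obtain s where s: "s \<in> C" "s \<le> q" "s \<le> r" using tot by blast
          then have "s (x + z) \<le> a + b"
            using sublinear_add[of s x z] CA[of s] qr by (smt (verit) le_funD)
          then show ?thesis using s by (auto simp: G_def)
        qed
        show "\<exists>b\<in>G (c *\<^sub>R x). b \<le> c * a" if ab: "a \<in> G x" "0 < c"
        proof -
          obtain q where q: "q \<in> C" "a = q x" using ab by (auto simp: G_def)
          then have "q (c *\<^sub>R x) = c * a" using CA[of q] ab by (simp add: sublinear_scale)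
          then show ?thesis using q(1) unfolding G_def by (metis image_eqI order_refl)
        qed
      qed
      have "sublinear (\<lambda>x. Inf (G x))" using prems by (rule sublinear_Inf)
      have bdd: "bdd_below (G x)" for x using prems by (rule sublinear_Inf(2))
      have le: "(\<lambda>x. Inf (G x)) \<le> q" if "q \<in> C" for q
        using that bdd by (auto simp: le_fun_def G_def intro: cInf_lower)
      obtain q where "q \<in> C" using False by blast
      then have "(\<lambda>x. Inf (G x)) \<le> p" using le CA order_trans by blast
      then show ?thesis using le \<open>sublinear (\<lambda>x. Inf (G x))\<close> by (auto simp: A_def)
    qed
  qed
  then obtain f where f: "sublinear f" "f \<le> p" and min: "\<And>q. sublinear q \<Longrightarrow> q \<le> p \<Longrightarrow> q \<le> f \<Longrightarrow> q = f"
    by (auto simp: A_def)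
  have neg: "f (- y) = - f y" for y
  proof -
    obtain q where "sublinear q" "q \<le> f" "q (- y) \<le> - f y"
      using sublinear_decrease[OF f(1)] .
    then have "f (- y) \<le> - f y" using min f order_trans by metis
    then show ?thesis using sublinear_minus[OF f(1), of y] by simp
  qed
  have "linear f"
  proof (rule linearI)
    show "f (x + y) = f x + f y" for x y
      using sublinear_add[OF f(1), of x y] sublinear_add[OF f(1), of "- x" "- y"] neg[of "x + y"] neg[of x] neg[of y]
      by simp
    show "f (c *\<^sub>R x) = c *\<^sub>R f x" for c x
    proof (cases "0 \<le> c")
      case True then show ?thesis using sublinear_scale[OF f(1)] by simp
    next
      case False
      then show ?thesis using sublinear_scale[OF f(1), of "- c" x] neg[of "c *\<^sub>R x"] by simp
    qed
  qed
  then show ?thesis using that f(2) by (simp add: le_fun_def)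
qed

section \<open>Separation and extension by bounded functionals\<close>

lemma bounded_linear_le_norm:
  fixes f :: "'a::real_normed_vector \<Rightarrow> real"
  assumes "linear f" "\<And>x. f x \<le> K * norm x"
  shows "bounded_linear f"
proof (rule bounded_linear_intro[where K = K])
  show "f (x + y) = f x + f y" "f (r *\<^sub>R x) = r *\<^sub>R f x" for x y r
    using assms(1) by (simp_all add: linear_add linear_scale)
  show "norm (f x) \<le> norm x * K" for x
    using assms(2)[of x] assms(2)[of "- x"] linear_neg[OF assms(1), of x]
    by (simp add: mult.commute abs_le_iff)
qed

text \<open>The sublinear functional \<open>p\<close> is the distance to \<open>M\<close>: it
  vanishes on \<open>M\<close> and is positive at \<open>v\<close> because \<open>M\<close> is
  closed. Decreasing it at \<open>v\<close> before Hahn-Banach is applied ensures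
  \<open>f v >= p v > 0\<close>.\<close>

lemma separate_point_closed_subspace:
  fixes M :: "'a::real_normed_vector set"
  assumes M: "closed M" "subspace M" and v: "v \<notin> M"
  obtains f :: "'a \<Rightarrow> real" where "bounded_linear f" "\<And>x. x \<in> M \<Longrightarrow> f x = 0" "f v \<noteq> 0"
proof -
  define G where "G x = (\<lambda>m. norm (x - m)) ` M" for x
  have 0: "0 \<in> M" using M subspace_0 by blast
  have prems: "G x \<noteq> {}" "a \<in> G 0 \<Longrightarrow> 0 \<le> a"
    "a \<in> G x \<Longrightarrow> b \<in> G z \<Longrightarrow> \<exists>c\<in>G (x + z). c \<le> a + b"
    "a \<in> G x \<Longrightarrow> 0 < c \<Longrightarrow> \<exists>b\<in>G (c *\<^sub>R x). b \<le> c * a" for x z a b c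
  proof -
    show "G x \<noteq> {}" using 0 by (auto simp: G_def)
    show "0 \<le> a" if "a \<in> G 0" using that by (auto simp: G_def)
    show "\<exists>c\<in>G (x + z). c \<le> a + b" if ab: "a \<in> G x" "b \<in> G z"
    proof -
      obtain m n where mn: "m \<in> M" "n \<in> M" "a = norm (x - m)" "b = norm (z - n)"
        using ab by (auto simp: G_def)
      then have "norm (x + z - (m + n)) \<le> a + b" by (metis add_diff_add norm_triangle_ineq)
      then show ?thesis using mn M(2) by (auto simp: G_def intro!: bexI[of _ "m + n"] subspace_add)
    qed
    show "\<exists>b\<in>G (c *\<^sub>R x). b \<le> c * a" if ab: "a \<in> G x" "0 < c"
    proof -
      obtain m where m: "m \<in> M" "a = norm (x - m)"
        using ab by (auto simp: G_def)
      then have "norm (c *\<^sub>R x - c *\<^sub>R m) \<le> c * a" using that by (simp flip: scaleR_diff_right)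
      then show ?thesis using m M(2) by (auto simp: G_def intro!: bexI[of _ "c *\<^sub>R m"] subspace_scale)
    qed
  qed
  define p where "p = (\<lambda>x. Inf (G x))"
  have p: "sublinear p" unfolding p_def using prems by (rule sublinear_Inf)
  have bdd: "bdd_below (G x)" for x using prems by (rule sublinear_Inf(2))
  have low: "p x \<le> norm (x - m)" if "m \<in> M" for x m
    using that bdd unfolding p_def G_def by (auto intro: cInf_lower)
  have pv: "p v > 0"
  proof -
    obtain e where e: "e > 0" "ball v e \<subseteq> - M"
      using M(1) v by (meson ComplI open_Compl open_contains_ball)
    then have e: "e > 0" "\<forall>m\<in>M. e \<le> dist v m"
      by (auto simp: subset_iff) (meson not_le)
    have "e \<le> p v" unfolding p_def
      by (rule cInf_greatest) (use prems e in \<open>auto simp: G_def dist_norm\<close>)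
    with e show ?thesis by simp
  qed
  obtain q where q: "sublinear q" "q \<le> p" "q (- v) \<le> - p v" using sublinear_decrease[OF p] .
  obtain f where f: "linear f" "\<And>x. f x \<le> q x" using Hahn_Banach_sublinear[OF q(1)] by blast
  have fp: "f x \<le> p x" for x using f q(2) by (meson le_funD order_trans)
  show ?thesis
  proof
    have "f x \<le> 1 * norm x" for x using fp[of x] low[OF 0, of x] by simp
    then show "bounded_linear f" by (rule bounded_linear_le_norm[OF f(1)])
    show "f x = 0" if "x \<in> M" for x
      using fp[of x] fp[of "- x"] low[OF that] low[OF subspace_neg[OF M(2) that]] linear_neg[OF f(1), of x]
      by (smt (verit) diff_self norm_zero)
    show "f v \<noteq> 0" using f(2)[of "- v"] q(3) pv linear_neg[OF f(1), of v] by simp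
  qed
qed

text \<open>The norm-controlled preimages make \<open>f\<close> bounded relative to
  \<open>B\<close>. With \<open>p y\<close> the infimum over \<open>x\<close> of
  \<open>f x + K * norm (y - B x)\<close>, a linear \<open>h <= p\<close> is bounded by
  \<open>K\<close> and satisfies \<open>h (B x) <= f x\<close>; the same at \<open>- x\<close> gives
  equality. Defining the functional on the range and extending it thus become one step.\<close>

lemma factor_functional_through_operator:
  fixes B :: "'a::real_normed_vector \<Rightarrow> 'b::real_normed_vector" and f :: "'a \<Rightarrow> real"
  assumes B: "linear B" and f: "bounded_linear f"
    and ker: "\<And>x. B x = 0 \<Longrightarrow> f x = 0"
    and C: "\<And>x. \<exists>x'. B x' = B x \<and> norm x' \<le> C * norm (B x)"
  obtains h where "bounded_linear h" "\<And>x. h (B x) = f x"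
proof -
  obtain L where L: "L > 0" "\<And>x. norm (f x) \<le> norm x * L" using bounded_linear.pos_bounded[OF f] by blast
  have lf: "linear f" using f by (simp add: bounded_linear.linear)
  have fB: "\<bar>f x\<bar> \<le> (L * C) * norm (B x)" for x
  proof -
    obtain x' where x': "B x' = B x" "norm x' \<le> C * norm (B x)" using C by blast
    have "f (x - x') = 0" using x'(1) by (intro ker) (simp add: linear_diff[OF B])
    then have "f x = f x'" by (simp add: linear_diff[OF lf])
    then have "\<bar>f x\<bar> \<le> norm x' * L" using L(2)[of x'] by simp
    also have "\<dots> \<le> (C * norm (B x)) * L" using x' L by simp
    finally show ?thesis by (simp add: mult_ac)
  qed
  \<comment> \<open>No sign of \<open>C\<close> is assumed, while \<open>K\<close> has to serve as a
    nonnegative factor.\<close>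
  define K where "K = max 0 (L * C)"
  have fK: "\<bar>f x\<bar> \<le> K * norm (B x)" for x
    using fB[of x] unfolding K_def by (smt (verit) max.cobounded2 mult_right_mono norm_ge_zero)
  have K0: "0 \<le> K" by (simp add: K_def)
  define G where "G y = range (\<lambda>x. f x + K * norm (y - B x))" for y
  have prems: "G x \<noteq> {}" "a \<in> G 0 \<Longrightarrow> 0 \<le> a"
    "a \<in> G x \<Longrightarrow> b \<in> G z \<Longrightarrow> \<exists>c\<in>G (x + z). c \<le> a + b"
    "a \<in> G x \<Longrightarrow> 0 < c \<Longrightarrow> \<exists>b\<in>G (c *\<^sub>R x). b \<le> c * a" for x z a b c
  proof -
    show "G x \<noteq> {}" by (auto simp: G_def)
    show "0 \<le> a" if "a \<in> G 0" using that fK by (auto simp: G_def) (smt (verit))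
    show "\<exists>c\<in>G (x + z). c \<le> a + b" if ab: "a \<in> G x" "b \<in> G z"
    proof -
      obtain m n where mn: "a = f m + K * norm (x - B m)" "b = f n + K * norm (z - B n)"
        using ab by (auto simp: G_def)
      have "norm (x + z - B (m + n)) \<le> norm (x - B m) + norm (z - B n)"
        by (metis add_diff_add linear_add[OF B] norm_triangle_ineq)
      then have "K * norm (x + z - B (m + n)) \<le> K * (norm (x - B m) + norm (z - B n))"
        using K0 by (rule mult_left_mono)
      then have "f (m + n) + K * norm (x + z - B (m + n)) \<le> a + b"
        using mn by (simp add: linear_add[OF lf] algebra_simps)
      then show ?thesis by (auto simp: G_def)
    qed
    show "\<exists>b\<in>G (c *\<^sub>R x). b \<le> c * a" if ab: "a \<in> G x" "0 < c"
    proof -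
      obtain m where m: "a = f m + K * norm (x - B m)"
        using ab by (auto simp: G_def)
      have "norm (c *\<^sub>R x - B (c *\<^sub>R m)) = c * norm (x - B m)"
        using that by (simp add: linear_scale[OF B] flip: scaleR_diff_right)
      then have "f (c *\<^sub>R m) + K * norm (c *\<^sub>R x - B (c *\<^sub>R m)) \<le> c * a"
        using m by (simp add: linear_scale[OF lf] algebra_simps)
      then show ?thesis by (auto simp: G_def)
    qed
  qed
  define p where "p = (\<lambda>x. Inf (G x))"
  have p: "sublinear p" unfolding p_def using prems by (rule sublinear_Inf)
  have bdd: "bdd_below (G x)" for x using prems by (rule sublinear_Inf(2))
  have low: "p y \<le> f x + K * norm (y - B x)" for x y
    using bdd unfolding p_def G_def by (auto intro: cInf_lower)
  obtain h where h: "linear h" "\<And>x. h x \<le> p x" using Hahn_Banach_sublinear[OF p] by blast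
  show ?thesis
  proof
    have "h y \<le> K * norm y" for y using h(2)[of y] low[of y 0] by (simp add: linear_0[OF lf] linear_0[OF B])
    then show "bounded_linear h" by (rule bounded_linear_le_norm[OF h(1)])
    have le: "h (B x) \<le> f x" for x using h(2)[of "B x"] low[of "B x" x] by simp
    show "h (B x) = f x" for x
      using le[of x] le[of "- x"] by (simp add: linear_neg[OF h(1)] linear_neg[OF lf] linear_neg[OF B])
  qed
qed

section \<open>Finite dimension and codimension\<close>

text \<open>Dimension bounds usually produce generators outside \<open>V\<close>, whereas
  \<open>fin_dim\<close> asks for generators inside. A maximal independent subset of
  \<open>V\<close> cannot have more elements than \<open>G\<close>.\<close>

lemma finite_spanning_subset:
  assumes "V \<subseteq> span G" "finite G"
  obtains F where "finite F" "F \<subseteq> V" "V \<subseteq> span F"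
proof -
  obtain B where B: "B \<subseteq> V" "independent B" "V \<subseteq> span B" by (rule maximal_independent_subset)
  then have "finite B" using independent_span_bound assms by (metis order_trans)
  then show ?thesis using B that by blast
qed

text \<open>Lift finitely many generators of the image to \<open>W\<close>; each vector of
  \<open>W\<close> differs from a combination of the lifts by an element of the kernel.\<close>

lemma span_kernel_Un_finite:
  fixes f :: "'a::real_vector \<Rightarrow> 'b::real_vector"
  assumes f: "linear f" and W: "subspace W" and G: "f ` W \<subseteq> span G" "finite G"
  obtains F where "finite F" "F \<subseteq> W" "W \<subseteq> span ({w \<in> W. f w = 0} \<union> F)"
proof -
  obtain B where B: "finite B" "B \<subseteq> f ` W" "f ` W \<subseteq> span B"
    using finite_spanning_subset[OF G] .
  obtain F where F: "F \<subseteq> W" "finite F" "B = f ` F" using finite_subset_image[OF B(1,2)] by blast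
  have "w \<in> span ({w \<in> W. f w = 0} \<union> F)" if w: "w \<in> W" for w
  proof -
    have "f w \<in> f ` span F" using B(3) F w linear_span_image[OF f, of F] by auto
    then obtain s where s: "s \<in> span F" "f w = f s" by blast
    have "s \<in> W" using s(1) F(1) W by (metis span_minimal subsetD)
    then have "w - s \<in> {w \<in> W. f w = 0}" using w s W by (simp add: subspace_diff linear_diff[OF f])
    then have "w - s \<in> span ({w \<in> W. f w = 0} \<union> F)" by (meson UnI1 span_base)
    moreover have "s \<in> span ({w \<in> W. f w = 0} \<union> F)" using s(1) by (meson Un_upper2 span_mono subsetD)
    ultimately show ?thesis by (metis diff_add_cancel span_add)
  qed
  then show ?thesis using that F by blast
qed

lemma finite_dim_if_kernel_and_image:
  fixes f :: "'a::real_vector \<Rightarrow> 'b::real_vector"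
  assumes f: "linear f" and W: "subspace W" and G: "f ` W \<subseteq> span G" "finite G"
    and K: "{w \<in> W. f w = 0} \<subseteq> span K" "finite K"
  obtains F where "finite F" "W \<subseteq> span F"
proof -
  obtain F where F: "finite F" "W \<subseteq> span ({w \<in> W. f w = 0} \<union> F)"
    using span_kernel_Un_finite[OF f W G] by metis
  have "span ({w \<in> W. f w = 0} \<union> F) \<subseteq> span (K \<union> F)"
  proof (rule span_minimal)
    show "{w \<in> W. f w = 0} \<union> F \<subseteq> span (K \<union> F)"
      using K(1) span_mono[of K "K \<union> F"] span_superset[of "K \<union> F"] by auto
  qed simp
  then show ?thesis using F K that[of "K \<union> F"] by auto
qed

text \<open>Steinitz exchange modulo \<open>R\<close>. If the generators are added one by one, the
  first one whose addition brings \<open>v\<close> into the span can be replaced by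
  \<open>v\<close>.\<close>

lemma span_exchange:
  assumes v: "v \<in> span (R \<union> G)" "v \<notin> span R" and G: "finite G"
  obtains g where "g \<in> G" "g \<in> span (insert v (R \<union> (G - {g})))"
proof -
  have "\<exists>g\<in>G. g \<in> span (insert v (R \<union> (G - {g})))" using G v
  proof (induction G)
    case empty then show ?case by simp
  next
    case (insert g G)
    show ?case
    proof (cases "v \<in> span (R \<union> G)")
      case True
      then obtain h where h: "h \<in> G" "h \<in> span (insert v (R \<union> (G - {h})))" using insert by blast
      then have "h \<in> span (insert v (R \<union> (insert g G - {h})))"
        by (meson Diff_mono Un_mono insert_mono order_refl span_mono subsetD subset_insertI)
      then show ?thesis using h by blast
    next
      case False
      then have "g \<in> span (insert v (R \<union> G))" using insert.prems by (simp add: in_span_insert)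
      then show ?thesis using insert.hyps by (metis Diff_insert_absorb insertI1)
    qed
  qed
  then show ?thesis using that by blast
qed

text \<open>The minimal number of vectors that generate \<^term>\<open>V\<close> modulo \<^term>\<open>R k\<close> is bounded, and it
  increases whenever \<^term>\<open>R k\<close> properly decreases.\<close>

lemma antitone_finite_codim_stable:
  fixes R :: "nat \<Rightarrow> 'a::real_vector set"
  assumes R: "\<And>k. subspace (R k)" "antimono R" "\<And>k. R k \<subseteq> V"
    and F: "finite F" "\<And>k. V \<subseteq> span (R k \<union> F)"
  obtains n where "\<And>m. n \<le> m \<Longrightarrow> R m = R n"
proof -
  define P where "P k d \<longleftrightarrow> (\<exists>G. finite G \<and> card G = d \<and> V \<subseteq> span (R k \<union> G))" for k d
  define d where "d k = (LEAST d. P k d)" for k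
  have PF: "P k (card F)" for k using F by (auto simp: P_def)
  have Pd: "P k (d k)" for k unfolding d_def using PF by (rule LeastI)
  have dle: "P k e \<Longrightarrow> d k \<le> e" for k e unfolding d_def by (rule Least_le)
  have mono: "R m \<subseteq> R k" if "k \<le> m" for k m using R(2) that by (auto simp: antimono_def)
  have strict: "d k < d m" if km: "k \<le> m" "R m \<noteq> R k" for k m
  proof -
    obtain v where v: "v \<in> R k" "v \<notin> R m" using mono[OF km(1)] km(2) by blast
    obtain G where G: "finite G" "card G = d m" "V \<subseteq> span (R m \<union> G)" using Pd[of m] by (auto simp: P_def)
    have "v \<in> span (R m \<union> G)" using v R(3) G by blast
    moreover have "v \<notin> span (R m)" using v R(1) by (simp add: span_eq_iff[THEN iffD2])
    ultimately obtain g where g: "g \<in> G" "g \<in> span (insert v (R m \<union> (G - {g})))"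
      using span_exchange G(1) by metis
    have "span (insert v (R m \<union> (G - {g}))) \<subseteq> span (R k \<union> (G - {g}))"
      using v mono[OF km(1)] by (intro span_mono) auto
    then have "R m \<union> G \<subseteq> span (R k \<union> (G - {g}))"
      using g mono[OF km(1)] span_superset[of "R k \<union> (G - {g})"] by auto
    then have "V \<subseteq> span (R k \<union> (G - {g}))" using G(3) span_minimal by (meson order_trans subspace_span)
    then have "P k (card (G - {g}))" using G by (auto simp: P_def)
    then have "d k \<le> card (G - {g})" by (rule dle)
    also have "\<dots> < d m" using G g by (metis card_Diff1_less)
    finally show ?thesis .
  qed
  have bnd: "d k \<le> card F" for k by (rule dle[OF PF])
  then have fin: "finite (range d)" by (auto simp: finite_nat_set_iff_bounded_le)
  obtain n where n: "d n = Max (range d)" using Max_in[OF fin] by auto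
  have "R m = R n" if "n \<le> m" for m
  proof (rule ccontr)
    assume "R m \<noteq> R n"
    then have "d n < d m" using strict that by blast
    then show False using n fin by (metis Max_ge not_le rangeI)
  qed
  then show ?thesis using that by blast
qed

text \<open>A bounded functional \<open>f\<close> that vanishes on \<open>M\<close> but not at
  \<open>v\<close> reads off the coefficient of \<open>v\<close> as \<open>f x / f v\<close>. The
  span is therefore the preimage of \<open>M\<close> under a continuous map.\<close>

lemma closed_span_insert:
  fixes M :: "'a::real_normed_vector set"
  assumes M: "closed M" "subspace M"
  shows "closed (span (insert v M))"
proof (cases "v \<in> M")
  case True
  then show ?thesis using M by (simp add: insert_absorb span_eq_iff[THEN iffD2])
next
  case False
  obtain f :: "'a \<Rightarrow> real" where f: "bounded_linear f" "\<And>x. x \<in> M \<Longrightarrow> f x = 0" "f v \<noteq> 0"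
    using separate_point_closed_subspace[OF M False] by metis
  have lf: "linear f" using f(1) by (simp add: bounded_linear.linear)
  have sM: "span M = M" using M by (simp add: span_eq_iff[THEN iffD2])
  have "k = f x / f v" if "x - k *\<^sub>R v \<in> M" for x k
    using f(2)[OF that] f(3) by (simp add: linear_diff[OF lf] linear_scale[OF lf])
  then have "span (insert v M) = (\<lambda>x. x - (f x / f v) *\<^sub>R v) -` M"
    unfolding span_insert sM by auto
  moreover have "continuous_on UNIV (\<lambda>x. x - (f x / f v) *\<^sub>R v)"
    using linear_continuous_on[OF f(1), of UNIV] f(3) by (auto intro!: continuous_intros)
  ultimately show ?thesis using M(1) by (simp add: closed_vimage)
qed

lemma closed_span_finite:
  fixes F :: "'a::real_normed_vector set"
  shows "finite F \<Longrightarrow> closed (span F)"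
proof (induction F rule: finite_induct)
  case (insert v F)
  have "span (insert v (span F)) = span (insert v F)"
    unfolding span_insert by (simp add: span_span)
  then show ?case using closed_span_insert[OF insert.IH subspace_span, of v] by simp
qed simp

lemma closed_subspace_finite_dim:
  fixes M :: "'a::real_normed_vector set"
  assumes "subspace M" "M \<subseteq> span F" "finite F"
  shows "closed M"
proof -
  obtain G where G: "finite G" "G \<subseteq> M" "M \<subseteq> span G" using finite_spanning_subset[OF assms(2,3)] .
  then have "span G = M" using assms(1) by (meson span_minimal subset_antisym)
  then show ?thesis using closed_span_finite[OF G(1)] by simp
qed

section \<open>Consequences of the Baire category theorem\<close>

text \<open>By Baire some \<open>E k\<close> contains a ball of \<open>W\<close> around some point
  \<open>x\<close>. Subtracting \<open>x\<close> moves the ball to the origin, at the price of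
  doubling the index. This serves both uniform boundedness and the open mapping theorem.\<close>

lemma Baire_closed_subspace:
  fixes W :: "'a::banach set" and E :: "nat \<Rightarrow> 'a set"
  assumes W: "closed W" "subspace W" and E: "\<And>k. closed (E k)" "W \<subseteq> (\<Union>k. E k)"
    and diff: "\<And>k x y. x \<in> E k \<Longrightarrow> y \<in> E k \<Longrightarrow> x - y \<in> E (2 * k)"
  obtains k r where "r > 0" "\<And>x. x \<in> W \<Longrightarrow> norm x < r \<Longrightarrow> x \<in> E k"
proof -
  have "\<exists>k. top_of_set W interior_of (W \<inter> E k) \<noteq> {}"
  proof (rule ccontr)
    assume *: "\<not> ?thesis"
    have "top_of_set W interior_of \<Union> (range (\<lambda>k. W \<inter> E k)) = {}"
    proof (rule Baire_category_alt)
      show "completely_metrizable_space (top_of_set W) \<or> locally_compact_space (top_of_set W) \<and> regular_space (top_of_set W)"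
        using W by (simp add: completely_metrizable_space_closedin completely_metrizable_space_euclidean)
      show "closedin (top_of_set W) T \<and> top_of_set W interior_of T = {}" if "T \<in> range (\<lambda>k. W \<inter> E k)" for T
        using that * E(1) W by (auto simp: closedin_closed_Int)
    qed simp
    moreover have "\<Union> (range (\<lambda>k. W \<inter> E k)) = topspace (top_of_set W)" using E(2) by auto
    ultimately have "W = {}" by (metis interior_of_topspace topspace_euclidean_subtopology)
    then show False using W(2) subspace_0 by blast
  qed
  then obtain k x where x: "x \<in> top_of_set W interior_of (W \<inter> E k)" by blast
  then obtain T where T: "open T" "x \<in> W \<inter> T" "W \<inter> T \<subseteq> E k"
    unfolding interior_of_def openin_open by auto
  then obtain r where r: "r > 0" "ball x r \<subseteq> T" by (metis IntD2 open_contains_ball)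
  have "w \<in> E (2 * k)" if w: "w \<in> W" "norm w < r" for w
  proof -
    have "x + w \<in> W" using T w W(2) by (auto intro: subspace_add)
    moreover have "x + w \<in> T" using r w by (auto simp: dist_norm)
    ultimately have "x + w - x \<in> E (2 * k)" using T by (intro diff) auto
    then show ?thesis by simp
  qed
  then show ?thesis using that r by blast
qed

lemma bounded_linear_funpow:
  fixes S :: "'a::real_normed_vector \<Rightarrow> 'a"
  assumes S: "bounded_linear S"
  shows "bounded_linear (S ^^ n)"
  by (induction n) (auto simp: bounded_linear_ident bounded_linear_compose[OF S] id_def o_def)

text \<open>The uniform boundedness principle for the powers of \<open>S\<close> weighted by
  \<open>1 / e ^ n\<close>, on a closed subspace.\<close>

lemma uniform_power_bound:
  fixes W :: "'a::banach set" and S :: "'a \<Rightarrow> 'a"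
  assumes W: "closed W" "subspace W" and S: "bounded_linear S" and e: "e > 0"
    and loc: "\<And>x. x \<in> W \<Longrightarrow> \<exists>C. \<forall>n. norm ((S ^^ n) x) \<le> C * e ^ n"
  obtains C where "\<And>x n. x \<in> W \<Longrightarrow> norm ((S ^^ n) x) \<le> C * e ^ n * norm x"
proof -
  note bl = bounded_linear_funpow[OF S]
  have lin: "linear (S ^^ n)" for n using bl bounded_linear.linear by blast
  define E where "E k = {x. \<forall>n. norm ((S ^^ n) x) \<le> real k * e ^ n}" for k
  have "\<exists>k r. r > 0 \<and> (\<forall>x\<in>W. norm x < r \<longrightarrow> x \<in> E k)"
  proof (rule Baire_closed_subspace[OF W, of E])
    show "closed (E k)" for k
    proof -
      have "E k = (\<Inter>n. {x. norm ((S ^^ n) x) \<le> real k * e ^ n})" by (auto simp: E_def)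
      moreover have "closed {x. norm ((S ^^ n) x) \<le> real k * e ^ n}" for n
        by (intro closed_Collect_le continuous_intros linear_continuous_on bl)
      ultimately show ?thesis by auto
    qed
    show "W \<subseteq> (\<Union>k. E k)"
    proof
      fix x assume "x \<in> W"
      then obtain C where C: "\<And>n. norm ((S ^^ n) x) \<le> C * e ^ n" using loc by blast
      obtain k :: nat where k: "C \<le> real k" using real_arch_simple by blast
      have "norm ((S ^^ n) x) \<le> real k * e ^ n" for n
        using C[of n] k e by (meson mult_right_mono order_trans zero_le_power less_imp_le)
      then show "x \<in> (\<Union>k. E k)" by (auto simp: E_def)
    qed
    show "x - y \<in> E (2 * k)" if "x \<in> E k" "y \<in> E k" for k x y
    proof -
      have "norm ((S ^^ n) (x - y)) \<le> real (2 * k) * e ^ n" for n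
      proof -
        have "norm ((S ^^ n) (x - y)) \<le> norm ((S ^^ n) x) + norm ((S ^^ n) y)"
          unfolding linear_diff[OF lin] by (rule norm_triangle_ineq4)
        also have "\<dots> \<le> real k * e ^ n + real k * e ^ n" using that by (intro add_mono) (auto simp: E_def)
        finally show ?thesis by simp
      qed
      then show ?thesis by (simp add: E_def)
    qed
  qed blast
  then obtain k r where kr: "r > 0" "\<And>x. x \<in> W \<Longrightarrow> norm x < r \<Longrightarrow> x \<in> E k" by blast
  have "norm ((S ^^ n) x) \<le> (2 * k / r) * e ^ n * norm x" if x: "x \<in> W" for x n
  proof (cases "x = 0")
    case True then show ?thesis by (simp add: linear_0[OF lin])
  next
    case False
    \<comment> \<open>The vector \<open>x\<close> is scaled to norm \<open>r / 2\<close>, inside the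
      ball supplied by Baire.\<close>
    define t where "t = r / (2 * norm x)"
    have t: "t > 0" using False kr by (simp add: t_def)
    have "norm (t *\<^sub>R x) < r" using False kr by (simp add: t_def)
    then have "t *\<^sub>R x \<in> E k" using x W(2) by (intro kr(2)) (auto intro: subspace_scale)
    then have "t * norm ((S ^^ n) x) \<le> real k * e ^ n"
      using t by (auto simp: E_def linear_scale[OF lin])
    then have "norm ((S ^^ n) x) \<le> real k * e ^ n / t" using t by (simp add: field_simps)
    also have "\<dots> = (2 * k / r) * e ^ n * norm x" by (simp add: t_def)
    finally show ?thesis .
  qed
  then show ?thesis using that by blast
qed

text \<open>Formulated for subspaces given as sets, since it is applied to ranges, to invariant
  subspaces and to a product with a finite-dimensional space, none of which is a type of its
  own.\<close>

theorem open_mapping_closed_subspaces: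
  fixes f :: "'a::banach \<Rightarrow> 'b::banach"
  assumes f: "bounded_linear f" and V: "closed V" "subspace V" and W: "closed W" "subspace W"
    and onto: "f ` V = W"
  obtains C where "C > 0" "\<And>y. y \<in> W \<Longrightarrow> \<exists>x\<in>V. f x = y \<and> norm x \<le> C * norm y"
proof -
  have lf: "linear f" using f by (simp add: bounded_linear.linear)
  define E where "E k = closure (f ` (V \<inter> cball 0 (real k)))" for k
  have "\<exists>k r. r > 0 \<and> (\<forall>x\<in>W. norm x < r \<longrightarrow> x \<in> E k)"
  proof (rule Baire_closed_subspace[OF W, of E])
    show "closed (E k)" for k by (simp add: E_def)
    show "W \<subseteq> (\<Union>k. E k)"
    proof
      fix y assume "y \<in> W"
      then obtain x where x: "x \<in> V" "y = f x" using onto by blast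
      obtain k :: nat where "norm x \<le> real k" using real_arch_simple by blast
      then have "y \<in> f ` (V \<inter> cball 0 (real k))" using x by auto
      then show "y \<in> (\<Union>k. E k)" unfolding E_def by (intro UN_I[of k] UNIV_I) (rule subsetD[OF closure_subset])
    qed
    show "x - y \<in> E (2 * k)" if xy: "x \<in> E k" "y \<in> E k" for k x y
    proof -
      obtain a where a: "\<And>n. a n \<in> f ` (V \<inter> cball 0 (real k))" "a \<longlonglongrightarrow> x"
        using xy(1) unfolding E_def closure_sequential by blast
      obtain b where b: "\<And>n. b n \<in> f ` (V \<inter> cball 0 (real k))" "b \<longlonglongrightarrow> y"
        using xy(2) unfolding E_def closure_sequential by blast
      have "a n - b n \<in> f ` (V \<inter> cball 0 (real (2 * k)))" for n
      proof -
        obtain u v where uv: "u \<in> V" "norm u \<le> k" "a n = f u" "v \<in> V" "norm v \<le> k" "b n = f v"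
          using a(1)[of n] b(1)[of n] by auto
        have "norm (u - v) \<le> real (2 * k)" using norm_triangle_ineq4[of u v] uv by simp
        moreover have "u - v \<in> V" using uv V(2) by (simp add: subspace_diff)
        moreover have "a n - b n = f (u - v)" using uv by (simp add: linear_diff[OF lf])
        ultimately show ?thesis by auto
      qed
      moreover have "(\<lambda>n. a n - b n) \<longlonglongrightarrow> x - y" using a b by (intro tendsto_diff)
      ultimately show ?thesis unfolding E_def closure_sequential
        by (intro exI[of _ "\<lambda>n. a n - b n"]) simp
    qed
  qed blast
  then obtain k r where r: "r > 0" and kr: "\<And>y. y \<in> W \<Longrightarrow> norm y < r \<Longrightarrow> y \<in> E k" by blast
  \<comment> \<open>A vector \<open>y\<close> is scaled by \<open>t = r / (2 * norm y)\<close> into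
    the ball and approximated by the image of a vector of norm at most \<open>k\<close>. Dividing by
    \<open>t\<close> gives the norm bound \<open>D * norm y\<close> and turns the tolerance
    \<open>r / 4\<close> into \<open>norm y / 2\<close>.\<close>
  define D where "D = 2 * real k / r"
  have D0: "D \<ge> 0" using r by (simp add: D_def)
  have approx: "\<exists>x\<in>V. norm x \<le> D * norm y \<and> norm (y - f x) \<le> norm y / 2" if y: "y \<in> W" for y
  proof (cases "y = 0")
    case True
    then show ?thesis using V(2) by (intro bexI[of _ 0]) (auto simp: linear_0[OF lf] subspace_0)
  next
    case False
    define t where "t = r / (2 * norm y)"
    have t: "t > 0" using r False by (simp add: t_def)
    have "norm (t *\<^sub>R y) < r" using r False by (simp add: t_def)
    then have "t *\<^sub>R y \<in> E k" using y W(2) by (intro kr) (simp_all add: subspace_scale)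
    moreover have "r / 4 > 0" using r by simp
    ultimately have "\<exists>z\<in>f ` (V \<inter> cball 0 (real k)). dist z (t *\<^sub>R y) < r / 4"
      unfolding E_def closure_approachable by blast
    then obtain x where x: "x \<in> V" "norm x \<le> k" "dist (f x) (t *\<^sub>R y) < r / 4"
      by auto
    have "norm (y - f (inverse t *\<^sub>R x)) = inverse t * norm (t *\<^sub>R y - f x)"
    proof -
      have "y - f (inverse t *\<^sub>R x) = inverse t *\<^sub>R (t *\<^sub>R y - f x)"
        using t by (simp add: linear_scale[OF lf] scaleR_diff_right)
      then show ?thesis using t by simp
    qed
    also have "\<dots> \<le> inverse t * (r / 4)"
      using x(3) t by (intro mult_left_mono) (auto simp: dist_norm norm_minus_commute)
    also have "\<dots> = norm y / 2" using r False by (simp add: t_def field_simps)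
    finally have 1: "norm (y - f (inverse t *\<^sub>R x)) \<le> norm y / 2" .
    have "norm (inverse t *\<^sub>R x) \<le> inverse t * real k" using x(2) t by simp
    also have "\<dots> = D * norm y" using r False by (simp add: t_def D_def field_simps)
    finally have "norm (inverse t *\<^sub>R x) \<le> D * norm y" .
    moreover have "inverse t *\<^sub>R x \<in> V" using x V(2) by (simp add: subspace_scale)
    ultimately show ?thesis using 1 by blast
  qed
  then obtain g where g: "\<And>y. y \<in> W \<Longrightarrow> g y \<in> V" "\<And>y. y \<in> W \<Longrightarrow> norm (g y) \<le> D * norm y"
    "\<And>y. y \<in> W \<Longrightarrow> norm (y - f (g y)) \<le> norm y / 2" by metis
  have main: "\<exists>x\<in>V. f x = y \<and> norm x \<le> (2 * D + 1) * norm y" if y: "y \<in> W" for y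
  proof -
    \<comment> \<open>\<open>u n\<close> is the error that remains after \<open>n\<close>
      approximate solutions. It is halved each time, so the approximate solutions
      \<open>g (u n)\<close> form an absolutely convergent series.\<close>
    define u where "u n = ((\<lambda>y. y - f (g y)) ^^ n) y" for n
    have uS: "u (Suc n) = u n - f (g (u n))" for n by (simp add: u_def)
    have uW: "u n \<in> W" for n
    proof (induction n)
      case 0 then show ?case using y by (simp add: u_def)
    next
      case (Suc n)
      have "f (g (u n)) \<in> W" using g(1)[OF Suc] onto by blast
      then show ?case unfolding uS using Suc W(2) by (simp add: subspace_diff)
    qed
    have un: "norm (u n) \<le> norm y * (1/2) ^ n" for n
    proof (induction n)
      case 0 then show ?case by (simp add: u_def)
    next
      case (Suc n)
      have "norm (u (Suc n)) \<le> norm (u n) / 2" unfolding uS using g(3)[OF uW] .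
      then show ?case using Suc by simp
    qed
    have gn: "norm (g (u n)) \<le> D * norm y * (1/2) ^ n" for n
      using g(2)[OF uW, of n] mult_left_mono[OF un[of n] D0] by (simp add: mult.assoc)
    have geo: "(\<lambda>n. D * norm y * (1/2) ^ n) sums (D * norm y * 2)"
      using sums_mult[OF geometric_sums[of "1/2::real"], of "D * norm y"] by simp
    have sn: "summable (\<lambda>n. norm (g (u n)))"
      by (rule summable_comparison_test'[OF sums_summable[OF geo], of 0]) (use gn in simp)
    then have sg: "summable (\<lambda>n. g (u n))" by (rule summable_norm_cancel)
    define x where "x = (\<Sum>n. g (u n))"
    have gx: "(\<lambda>n. g (u n)) sums x" unfolding x_def using sg by (rule summable_sums)
    have "(\<lambda>n. f (g (u n))) sums f x" by (rule bounded_linear.sums[OF f gx])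
    moreover have "(\<lambda>n. f (g (u n))) sums y"
    proof -
      have "u \<longlonglongrightarrow> 0"
      proof (rule Lim_null_comparison)
        show "(\<lambda>n. norm y * (1/2) ^ n) \<longlonglongrightarrow> 0"
          by (intro tendsto_mult_right_zero LIMSEQ_power_zero) simp
      qed (use un in auto)
      then have "(\<lambda>n. u n - u (Suc n)) sums (u 0 - 0)" by (rule telescope_sums')
      then show ?thesis by (simp add: uS) (simp add: u_def)
    qed
    ultimately have "f x = y" by (rule sums_unique2)
    moreover have "norm x \<le> (2 * D + 1) * norm y"
    proof -
      have "norm x \<le> (\<Sum>n. norm (g (u n)))" unfolding x_def by (rule summable_norm[OF sn])
      also have "\<dots> \<le> D * norm y * 2"
        using suminf_le[OF gn sn sums_summable[OF geo]] sums_unique[OF geo] by simp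
      also have "\<dots> \<le> (2 * D + 1) * norm y" by (simp add: algebra_simps)
      finally show ?thesis .
    qed
    moreover have "x \<in> V"
    proof -
      have "(\<Sum>i<n. g (u i)) \<in> V" for n using g(1)[OF uW] V(2) by (simp add: subspace_sum)
      moreover have "(\<lambda>n. \<Sum>i<n. g (u i)) \<longlonglongrightarrow> x" using gx by (simp add: sums_def)
      ultimately show ?thesis using V(1) by (meson closed_sequentially)
    qed
    ultimately show ?thesis by blast
  qed
  \<comment> \<open>The summand 1 makes the constant positive even if \<open>D\<close> is 0.\<close>
  show ?thesis by (rule that[of "2 * D + 1"]) (use D0 main in auto)
qed

text \<open>A finite-dimensional algebraic complement \<open>span G\<close> of the range makes
  \<open>(x, b)\<close> to \<open>f x + b\<close> a surjection from a Banach space. By the open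
  mapping theorem the projection onto \<open>span G\<close> along the range is bounded, and the
  range is its kernel.\<close>

lemma closed_range_finite_codim:
  fixes f :: "'a::banach \<Rightarrow> 'b::banach"
  assumes f: "bounded_linear f" and F: "finite F" "span (range f \<union> F) = UNIV"
  shows "closed (range f)"
proof -
  have lf: "linear f" using f by (simp add: bounded_linear.linear)
  have sR: "subspace (range f)" using lf by (simp add: linear_subspace_image)
  obtain B where B: "B \<subseteq> range f" "independent B" "range f \<subseteq> span B"
    by (rule maximal_independent_subset)
  have spB: "span B = range f" using B sR by (meson span_minimal subset_antisym)
  \<comment> \<open>A Hamel basis of the range is extended by vectors of \<open>F\<close> only, so
    the complement is spanned by a finite set.\<close>
  obtain B' where B': "B \<subseteq> B'" "B' \<subseteq> B \<union> F" "independent B'" "B \<union> F \<subseteq> span B'"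
    using maximal_independent_subset_extend[of B "B \<union> F"] B(2) by blast
  define G where "G = B' - B"
  have finG: "finite G" using B'(2) F(1) by (auto simp: G_def intro: finite_subset)
  have "range f \<union> F \<subseteq> span B'" using B'(1,4) spB span_mono[OF B'(1)] by auto
  then have spB': "span (range f \<union> G) = UNIV"
  proof -
    have "B' \<subseteq> span (range f \<union> G)" using spB span_superset[of B] span_superset[of "range f \<union> G"]
      by (auto simp: G_def)
    then have "range f \<union> F \<subseteq> span (range f \<union> G)"
      using \<open>range f \<union> F \<subseteq> span B'\<close> by (meson order_trans span_minimal subspace_span)
    then show ?thesis using F(2) span_minimal[of "range f \<union> F" "span (range f \<union> G)"] by auto
  qed
  obtain \<pi> where \<pi>: "linear \<pi>" "\<And>b. b \<in> B' \<Longrightarrow> \<pi> b = (if b \<in> B then 0 else b)"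
    using linear_independent_extend[OF B'(3), of "\<lambda>b. if b \<in> B then 0 else b"] by blast
  have \<pi>R: "\<pi> y = 0" if y: "y \<in> range f" for y
    by (rule linear_eq_0_on_span[OF \<pi>(1), of B]) (use \<pi>(2) B'(1) y spB in auto)
  have \<pi>G: "\<pi> y = y" if y: "y \<in> span G" for y
    by (rule linear_eq_on_span[OF \<pi>(1) linear_ident, of G]) (use \<pi>(2) y in \<open>auto simp: G_def\<close>)
  define h where "h = (\<lambda>z. f (fst z) + snd z)"
  have h: "bounded_linear h" unfolding h_def
    by (intro bounded_linear_add bounded_linear_compose[OF f] bounded_linear_fst bounded_linear_snd)
  have dec: "y \<in> h ` (UNIV \<times> span G)" for y
  proof -
    have "y \<in> span (range f \<union> G)" using spB' by simp
    then obtain a b where "a \<in> span (range f)" "b \<in> span G" "y = a + b" unfolding span_Un by auto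
    moreover have "span (range f) = range f" using sR by (simp add: span_eq_iff[THEN iffD2])
    ultimately show ?thesis by (auto simp: h_def image_iff)
  qed
  obtain C where C: "C > 0" "\<And>y. y \<in> UNIV \<Longrightarrow> \<exists>x\<in>UNIV \<times> span G. h x = y \<and> norm x \<le> C * norm y"
  proof (rule open_mapping_closed_subspaces[OF h])
    show "closed (UNIV \<times> span G)" by (intro closed_Times closed_UNIV closed_span_finite finG)
    show "subspace (UNIV \<times> span G)" by (intro subspace_Times subspace_UNIV subspace_span)
    show "h ` (UNIV \<times> span G) = UNIV" using dec by blast
  qed auto
  have \<pi>b: "norm (\<pi> y) \<le> norm y * C" and \<pi>0: "\<pi> y = 0 \<Longrightarrow> y \<in> range f" for y
  proof -
    obtain a b where ab: "b \<in> span G" "f a + b = y" "norm (a, b) \<le> C * norm y"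
      using C(2)[of y] by (auto simp: h_def)
    have "\<pi> y = b" using ab by (metis \<pi>G \<pi>R add_0 linear_add[OF \<pi>(1)] rangeI)
    then show "norm (\<pi> y) \<le> norm y * C" using ab(3) norm_snd_le[of b a] by (simp add: mult.commute)
    show "y \<in> range f" if "\<pi> y = 0" using that \<open>\<pi> y = b\<close> ab(2) by auto
  qed
  have "bounded_linear \<pi>"
    by (rule bounded_linear_intro[OF _ _ \<pi>b]) (simp_all add: linear_add[OF \<pi>(1)] linear_scale[OF \<pi>(1)])
  then have "closed (\<pi> -` {0})"
    by (intro closed_vimage closed_singleton linear_continuous_on)
  moreover have "range f = \<pi> -` {0}" using \<pi>R \<pi>0 by auto
  ultimately show ?thesis by simp
qed

section \<open>Quasinilpotent part and analytic core\<close>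

text \<open>The limit of roots is replaced by geometric bounds for every rate \<open>e\<close>.
  These behave well under sums, multiples and index shifts and are what the Baire argument
  needs.\<close>

lemma mem_H0_iff:
  "x \<in> H0 V S \<longleftrightarrow> x \<in> V \<and> (\<forall>e>0. \<exists>C. \<forall>n. norm ((S ^^ n) x) \<le> C * e ^ n)"
proof -
  define a where "a n = norm ((S ^^ n) x)" for n
  have a0: "a n \<ge> 0" for n by (simp add: a_def)
  have "(\<lambda>n. root n (a n)) \<longlonglongrightarrow> 0 \<longleftrightarrow> (\<forall>e>0. \<exists>C. \<forall>n. a n \<le> C * e ^ n)"
  proof (intro iffI allI impI)
    fix e :: real assume lim: "(\<lambda>n. root n (a n)) \<longlonglongrightarrow> 0" and e: "e > 0"
    obtain N where N: "\<And>n. n \<ge> N \<Longrightarrow> norm (root n (a n) - 0) < e" using LIMSEQ_D[OF lim e] by blast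
    \<comment> \<open>The sum takes care of the indices up to \<open>N\<close>, among them 0, where
      \<open>root\<close> has the default value 0; the summand 1 takes care of the others.\<close>
    define C where "C = 1 + (\<Sum>n<Suc N. a n / e ^ n)"
    have "a n \<le> C * e ^ n" for n
    proof (cases "n < Suc N")
      case True
      have "a n / e ^ n \<le> (\<Sum>n<Suc N. a n / e ^ n)"
        by (rule member_le_sum) (use True a0 e in auto)
      then have "a n / e ^ n \<le> C" by (simp add: C_def)
      then show ?thesis using e by (simp add: field_simps)
    next
      case False
      then have n: "n > 0" "n \<ge> N" by auto
      have "root n (a n) ^ n \<le> e ^ n" using N[OF n(2)] a0 n by (intro power_mono) auto
      then have "a n \<le> e ^ n" using n a0 by simp
      moreover have "1 \<le> C" unfolding C_def using a0 e by (simp add: sum_nonneg)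
      then have "1 * e ^ n \<le> C * e ^ n" using e by (intro mult_right_mono) auto
      ultimately show ?thesis by simp
    qed
    then show "\<exists>C. \<forall>n. a n \<le> C * e ^ n" by blast
  next
    assume B: "\<forall>e>0. \<exists>C. \<forall>n. a n \<le> C * e ^ n"
    show "(\<lambda>n. root n (a n)) \<longlonglongrightarrow> 0"
    proof (rule LIMSEQ_I)
      fix r :: real assume r: "r > 0"
      \<comment> \<open>With the rate \<open>r / 2\<close> in place of \<open>r\<close> the constant
        \<open>C\<close> is absorbed by \<open>2 ^ n\<close> for large \<open>n\<close>.\<close>
      then obtain C where C: "\<And>n. a n \<le> C * (r / 2) ^ n" using B half_gt_zero by blast
      obtain N where N: "C < 2 ^ N" using real_arch_pow[of 2 C] by auto
      have "norm (root n (a n) - 0) < r" if n: "n \<ge> Suc N" for n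
      proof -
        have "C < 2 ^ n" using N n by (smt (verit) Suc_leD power_increasing)
        have "a n \<le> C * (r / 2) ^ n" by (rule C)
        also have "\<dots> < 2 ^ n * (r / 2) ^ n" using \<open>C < 2 ^ n\<close> r by (intro mult_strict_right_mono) auto
        also have "\<dots> = r ^ n" by (simp add: power_divide)
        finally have "root n (a n) < root n (r ^ n)" using n by simp
        then show ?thesis using n r a0 by (simp add: real_root_power_cancel)
      qed
      then show "\<exists>no. \<forall>n\<ge>no. norm (root n (a n) - 0) < r" by blast
    qed
  qed
  then show ?thesis by (simp add: H0_def a_def)
qed

lemma subspace_H0:
  assumes V: "subspace V" and S: "linear S"
  shows "subspace (H0 V S)"
proof (rule subspaceI)
  have lin: "linear (S ^^ n)" for n
    by (induction n) (auto simp: id_def o_def linear_ident linear_compose[OF _ S, unfolded o_def])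
  show "0 \<in> H0 V S" unfolding mem_H0_iff
    using subspace_0[OF V] by (auto simp: linear_0[OF lin] intro!: exI[of _ 0])
  show "x + y \<in> H0 V S" if xy: "x \<in> H0 V S" "y \<in> H0 V S" for x y
    unfolding mem_H0_iff
  proof (intro conjI allI impI)
    show "x + y \<in> V" using xy V by (auto simp: mem_H0_iff subspace_add)
    fix e :: real assume "e > 0"
    then obtain C D where "\<And>n. norm ((S ^^ n) x) \<le> C * e ^ n" "\<And>n. norm ((S ^^ n) y) \<le> D * e ^ n"
      using xy unfolding mem_H0_iff by meson
    then have "norm ((S ^^ n) (x + y)) \<le> (C + D) * e ^ n" for n
      unfolding linear_add[OF lin] distrib_right by (meson add_mono norm_triangle_le)
    then show "\<exists>C. \<forall>n. norm ((S ^^ n) (x + y)) \<le> C * e ^ n" by blast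
  qed
  show "c *\<^sub>R x \<in> H0 V S" if x: "x \<in> H0 V S" for c x
    unfolding mem_H0_iff
  proof (intro conjI allI impI)
    show "c *\<^sub>R x \<in> V" using x V by (auto simp: mem_H0_iff subspace_scale)
    fix e :: real assume "e > 0"
    then obtain C where "\<And>n. norm ((S ^^ n) x) \<le> C * e ^ n"
      using x unfolding mem_H0_iff by meson
    then have "norm ((S ^^ n) (c *\<^sub>R x)) \<le> (\<bar>c\<bar> * C) * e ^ n" for n
      by (simp add: linear_scale[OF lin] mult.assoc mult_left_mono)
    then show "\<exists>C. \<forall>n. norm ((S ^^ n) (c *\<^sub>R x)) \<le> C * e ^ n" by blast
  qed
qed

text \<open>Applying \<open>S\<close> shifts the orbit by one index, which changes only the
  constants; the maximum with \<open>norm x\<close> covers index 0.\<close>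

lemma H0_apply_iff:
  assumes "x \<in> V" "S x \<in> V"
  shows "S x \<in> H0 V S \<longleftrightarrow> x \<in> H0 V S"
  unfolding mem_H0_iff
proof (intro iffI conjI allI impI; (elim conjE)?)
  fix e :: real assume e: "e > 0"
  {
    assume "\<forall>e>0. \<exists>C. \<forall>n. norm ((S ^^ n) (S x)) \<le> C * e ^ n"
    then obtain C where C: "\<And>n. norm ((S ^^ n) (S x)) \<le> C * e ^ n" using e by blast
    have "norm ((S ^^ n) x) \<le> max (norm x) (C / e) * e ^ n" for n
    proof (cases n)
      case (Suc m)
      have "norm ((S ^^ n) x) \<le> C / e * e ^ n"
        using C[of m] e by (simp add: Suc funpow_swap1)
      also have "\<dots> \<le> max (norm x) (C / e) * e ^ n" using e by (intro mult_right_mono) auto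
      finally show ?thesis .
    qed simp
    then show "\<exists>C. \<forall>n. norm ((S ^^ n) x) \<le> C * e ^ n" by blast
  }
  {
    assume "\<forall>e>0. \<exists>C. \<forall>n. norm ((S ^^ n) x) \<le> C * e ^ n"
    then obtain C where C: "\<And>n. norm ((S ^^ n) x) \<le> C * e ^ n" using e by blast
    have "norm ((S ^^ n) (S x)) \<le> (C * e) * e ^ n" for n
      using C[of "Suc n"] by (simp add: funpow_swap1 mult_ac)
    then show "\<exists>C. \<forall>n. norm ((S ^^ n) (S x)) \<le> C * e ^ n" by blast
  }
qed (use assms in auto)

lemma kernel_funpow_subset_H0:
  assumes S: "linear S"
  shows "kernel_on V (S ^^ p) \<subseteq> H0 V S"
proof
  fix x assume x: "x \<in> kernel_on V (S ^^ p)"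
  have "(S ^^ n) x = 0" if n: "p \<le> n" for n
  proof -
    have "(S ^^ n) x = (S ^^ (n - p)) ((S ^^ p) x)"
      using n by (metis comp_apply funpow_add le_add_diff_inverse2)
    moreover have "(S ^^ k) 0 = 0" for k by (induction k) (auto simp: linear_0[OF S])
    ultimately show ?thesis using x by (simp add: kernel_on_def)
  qed
  then have "\<exists>C. \<forall>n. norm ((S ^^ n) x) \<le> C * e ^ n" if e: "e > 0" for e
  proof -
    have "norm ((S ^^ n) x) \<le> (\<Sum>n<p. norm ((S ^^ n) x) / e ^ n) * e ^ n" for n
    proof (cases "n < p")
      case True
      have "norm ((S ^^ n) x) / e ^ n \<le> (\<Sum>n<p. norm ((S ^^ n) x) / e ^ n)"
        by (rule member_le_sum) (use True e in auto)
      then show ?thesis using e by (simp add: field_simps)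
    next
      case False
      then have "(S ^^ n) x = 0" using \<open>\<And>n. p \<le> n \<Longrightarrow> (S ^^ n) x = 0\<close> by simp
      then show ?thesis using e by (simp add: sum_nonneg)
    qed
    then show ?thesis by blast
  qed
  then show "x \<in> H0 V S" using x by (auto simp: mem_H0_iff kernel_on_def)
qed

text \<open>The norm-controlled preimages of the open mapping theorem are iterated inside
  \<open>R\<close>. The rate \<open>C\<close> is later played off against the arbitrarily small
  rates of quasinilpotency.\<close>

lemma iterated_preimage_bound:
  fixes S :: "'a::banach \<Rightarrow> 'a"
  assumes S: "bounded_linear S" and R: "closed R" "subspace R" "S ` R = R"
  obtains C where "C > 0" "\<And>x n. x \<in> R \<Longrightarrow> \<exists>z\<in>R. (S ^^ n) z = x \<and> norm z \<le> C ^ n * norm x"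
proof -
  obtain C where C: "C > 0" "\<And>y. y \<in> R \<Longrightarrow> \<exists>x\<in>R. S x = y \<and> norm x \<le> C * norm y"
    using open_mapping_closed_subspaces[OF S R(1,2) R(1,2) R(3)] by blast
  have "\<exists>z\<in>R. (S ^^ n) z = x \<and> norm z \<le> C ^ n * norm x" if x: "x \<in> R" for x n
  proof (induction n)
    case 0 then show ?case using x by auto
  next
    case (Suc n)
    then obtain z where z: "z \<in> R" "(S ^^ n) z = x" "norm z \<le> C ^ n * norm x" by blast
    obtain w where w: "w \<in> R" "S w = z" "norm w \<le> C * norm z" using C(2)[OF z(1)] by blast
    have "norm w \<le> C * (C ^ n * norm x)" using w(3) z(3) C(1) by (meson mult_left_mono less_imp_le order_trans)
    then show ?case using w z by (intro bexI[of _ w]) (auto simp: funpow_swap1 mult.assoc)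
  qed
  then show ?thesis using that C(1) by blast
qed

text \<open>The open mapping theorem supplies a right inverse \<open>g\<close> on \<open>R\<close>
  with \<open>norm (g y) <= C * norm y\<close>; its orbit of \<open>x\<close> is the sequence that
  the analytic core requires.\<close>

lemma invariant_subset_Kcore:
  fixes S :: "'a::banach \<Rightarrow> 'a"
  assumes S: "bounded_linear S" and R: "closed R" "subspace R" "S ` R = R" "R \<subseteq> V"
  shows "R \<subseteq> Kcore V S"
proof
  fix x assume x: "x \<in> R"
  obtain C where C: "C > 0" "\<And>y. y \<in> R \<Longrightarrow> \<exists>x\<in>R. S x = y \<and> norm x \<le> C * norm y"
    using open_mapping_closed_subspaces[OF S R(1,2) R(1,2) R(3)] by blast
  then obtain g where g: "\<And>y. y \<in> R \<Longrightarrow> g y \<in> R" "\<And>y. y \<in> R \<Longrightarrow> S (g y) = y"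
    "\<And>y. y \<in> R \<Longrightarrow> norm (g y) \<le> C * norm y" by metis
  define u where "u n = (g ^^ n) x" for n
  have uR: "u n \<in> R" for n by (induction n) (use x g in \<open>auto simp: u_def\<close>)
  have un: "norm (u n) \<le> C ^ n * norm x" for n
  proof (induction n)
    case (Suc n)
    have "norm (u (Suc n)) \<le> C * norm (u n)" using g(3)[OF uR] by (simp add: u_def)
    also have "\<dots> \<le> C * (C ^ n * norm x)" using Suc C(1) by (intro mult_left_mono) auto
    finally show ?case by (simp add: mult.assoc)
  qed (simp add: u_def)
  have "S (u (Suc n)) = u n" for n using g(2)[OF uR] by (simp add: u_def)
  then have "u 0 = x \<and> (\<forall>n. u n \<in> V \<and> S (u (Suc n)) = u n \<and> norm (u n) \<le> C ^ n * norm x)"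
    using un uR R(4) by (auto simp: u_def)
  then show "x \<in> Kcore V S" unfolding Kcore_def using x R(4) C(1) by blast
qed

lemma Kcore_subset_range: "Kcore V S \<subseteq> (S ^^ n) ` V"
proof
  fix x assume "x \<in> Kcore V S"
  then obtain u where u: "u 0 = x" "\<And>n. u n \<in> V" "\<And>n. S (u (Suc n)) = u n"
    by (auto simp: Kcore_def)
  have "(S ^^ n) (u n) = x" by (induction n) (auto simp: u funpow_swap1)
  then show "x \<in> (S ^^ n) ` V" using u(2) by blast
qed

text \<open>\<^term>\<open>S\<close> maps \<^term>\<open>M\<close>, the intersection of \<^term>\<open>H0 V S\<close> with all ranges, onto itself, so
  preimages grow at most geometrically; but \<^term>\<open>S\<close> is uniformly quasinilpotent there.
  Hence \<^term>\<open>M\<close> is trivial.\<close>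

theorem finite_ascent_if_closed_H0:
  fixes S :: "'a::banach \<Rightarrow> 'a"
  assumes S: "bounded_linear S" and V: "subspace V" "S ` V \<subseteq> V"
    and H: "closed (H0 V S)"
    and K: "finite K" "kernel_on V S \<subseteq> span K"
    and cl: "\<And>n. closed ((S ^^ n) ` V)"
  shows "\<exists>n. kernel_on V (S ^^ n) = kernel_on V (S ^^ Suc n)"
proof -
  have lS: "linear S" using S by (simp add: bounded_linear.linear)
  have lin: "linear (S ^^ n)" for n using bounded_linear_funpow[OF S] bounded_linear.linear by blast
  define R where "R n = (S ^^ n) ` V" for n
  define N where "N = kernel_on V S"
  have sR: "subspace (R n)" for n unfolding R_def using linear_subspace_image[OF lin V(1)] .
  have RSuc: "R (Suc n) \<subseteq> R n" for n unfolding R_def using V(2) by (auto simp: funpow_swap1)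
  have Rmono: "R m \<subseteq> R n" if "n \<le> m" for m n using lift_Suc_antimono_le[of R, OF RSuc that] .
  have RS: "R (Suc n) = S ` R n" for n unfolding R_def by (auto simp: image_image)
  have R0: "R 0 = V" by (simp add: R_def)
  have sN: "subspace N" unfolding N_def kernel_on_def using V(1)
    by (auto simp: subspace_def linear_0[OF lS] linear_add[OF lS] linear_scale[OF lS])
  \<comment> \<open>As \<open>N\<close> is finite-dimensional, the decreasing subspaces
    \<open>N\<close> intersected with \<open>R m\<close> become stationary.\<close>
  obtain n0 where n0: "\<And>m. n0 \<le> m \<Longrightarrow> N \<inter> R m = N \<inter> R n0"
  proof (rule antitone_finite_codim_stable[of "\<lambda>k. N \<inter> R k" N K])
    show "subspace (N \<inter> R k)" for k using sN sR by (rule subspace_inter)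
    show "antimono (\<lambda>k. N \<inter> R k)" using Rmono by (auto simp: antimono_def)
    show "N \<subseteq> span (N \<inter> R k \<union> K)" for k
      using K(2) span_mono[of K "N \<inter> R k \<union> K"] by (auto simp: N_def)
  qed (use K in auto)
  define M where "M = H0 V S \<inter> (\<Inter>n. R n)"
  have cM: "closed M" unfolding M_def using H cl by (auto simp: R_def)
  have sM: "subspace M" unfolding M_def
    using subspace_H0[OF V(1) lS] sR by (intro subspace_inter subspace_Inter) auto
  have MV: "M \<subseteq> V" by (auto simp: M_def R0[symmetric])
  have SM: "S ` M = M"
  proof (intro equalityI subsetI)
    fix y assume "y \<in> S ` M"
    then obtain x where x: "x \<in> M" "y = S x" by blast
    then have "S x \<in> H0 V S" using MV V(2) H0_apply_iff[of x V S] by (auto simp: M_def)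
    moreover have "S x \<in> R n" for n using x(1) RS[of n] RSuc[of n] by (auto simp: M_def)
    ultimately show "y \<in> M" using x by (auto simp: M_def)
  next
    fix y assume y: "y \<in> M"
    then have "y \<in> S ` R n0" unfolding RS[symmetric] by (auto simp: M_def)
    then obtain x where x: "x \<in> R n0" "y = S x" by blast
    \<comment> \<open>A preimage of \<open>y\<close> in \<open>R m\<close> differs from
      \<open>x\<close> by an element of \<open>N\<close> in \<open>R n0\<close>, hence of
      \<open>R m\<close>. So the one preimage \<open>x\<close> lies in all ranges.\<close>
    have big: "x \<in> R m" if m: "n0 \<le> m" for m
    proof -
      have "y \<in> S ` R m" using y unfolding RS[symmetric] by (auto simp: M_def)
      then obtain z where z: "z \<in> R m" "y = S z" by blast
      have "x - z \<in> R n0" using x z Rmono[OF m] sR by (auto intro: subspace_diff)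
      moreover have "x - z \<in> N" using x z \<open>x - z \<in> R n0\<close> Rmono[of 0 n0] R0
        by (auto simp: N_def kernel_on_def linear_diff[OF lS])
      ultimately have "x - z \<in> R m" using n0[OF m] by blast
      then show ?thesis using z(1) sR by (metis diff_add_cancel subspace_add)
    qed
    have xR: "x \<in> R m" for m using big[of "max m n0"] Rmono[of m "max m n0"] by auto
    then have "x \<in> V" using R0 by blast
    moreover have "S x \<in> V" using \<open>x \<in> V\<close> V(2) by blast
    ultimately have "x \<in> H0 V S" using y x H0_apply_iff[of x V S] by (auto simp: M_def)
    then have "x \<in> M" using xR by (auto simp: M_def)
    then show "y \<in> S ` M" using x by blast
  qed
  obtain C where C: "C > 0" "\<And>x n. x \<in> M \<Longrightarrow> \<exists>z\<in>M. (S ^^ n) z = x \<and> norm z \<le> C ^ n * norm x"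
    using iterated_preimage_bound[OF S cM sM SM] by metis
  \<comment> \<open>With decay rate \<open>1 / (2 * C)\<close> and preimages growing like
    \<open>C ^ n\<close>, the factor \<open>2 ^ n\<close> remains in the denominator.\<close>
  have e: "1 / (2 * C) > 0" using C by simp
  obtain D where D: "\<And>x n. x \<in> M \<Longrightarrow> norm ((S ^^ n) x) \<le> D * (1 / (2 * C)) ^ n * norm x"
  proof (rule uniform_power_bound[OF cM sM S e])
    show "\<exists>B. \<forall>n. norm ((S ^^ n) x) \<le> B * (1 / (2 * C)) ^ n" if "x \<in> M" for x
      using that e by (auto simp: M_def mem_H0_iff)
  qed blast
  have M0: "x = 0" if x: "x \<in> M" for x
  proof (rule ccontr)
    assume "x \<noteq> 0"
    obtain n where n: "\<bar>D\<bar> < 2 ^ n" using real_arch_pow[of 2 "\<bar>D\<bar>"] by auto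
    obtain z where z: "z \<in> M" "(S ^^ n) z = x" "norm z \<le> C ^ n * norm x" using C(2)[OF x] by blast
    have "norm x \<le> D * (1 / (2 * C)) ^ n * norm z" using D[OF z(1), of n] z(2) by simp
    also have "\<dots> \<le> \<bar>D\<bar> * (1 / (2 * C)) ^ n * norm z" using e by (intro mult_right_mono) auto
    also have "\<dots> \<le> \<bar>D\<bar> * (1 / (2 * C)) ^ n * (C ^ n * norm x)" using e z(3) by (intro mult_left_mono) auto
    also have "\<dots> = \<bar>D\<bar> / 2 ^ n * norm x" using C(1) by (simp add: power_divide power_mult_distrib)
    also have "\<dots> < 1 * norm x" using n \<open>x \<noteq> 0\<close> by (intro mult_strict_right_mono) auto
    finally show False by simp
  qed
  \<comment> \<open>By the choice of \<open>n0\<close> such an \<open>x\<close> lies in all ranges,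
    and the kernel is part of \<open>H0\<close>; so \<open>x\<close> belongs to the trivial space
    \<open>M\<close>.\<close>
  have NR: "x = 0" if x: "x \<in> N" "x \<in> R n0" for x
  proof (rule M0)
    have "x \<in> R m" for m
    proof (cases "n0 \<le> m")
      case True then show ?thesis using n0[OF True] x by blast
    next
      case False then show ?thesis using Rmono[of m n0] x by auto
    qed
    moreover have "x \<in> H0 V S"
      using kernel_funpow_subset_H0[OF lS, of V 1] x(1) by (auto simp: N_def)
    ultimately show "x \<in> M" by (auto simp: M_def)
  qed
  have "kernel_on V (S ^^ n0) = kernel_on V (S ^^ Suc n0)"
  proof (intro equalityI subsetI)
    fix x assume "x \<in> kernel_on V (S ^^ n0)"
    then show "x \<in> kernel_on V (S ^^ Suc n0)" by (auto simp: kernel_on_def linear_0[OF lS])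
  next
    fix x assume x: "x \<in> kernel_on V (S ^^ Suc n0)"
    have "(S ^^ n0) x \<in> R n0" using x by (auto simp: R_def kernel_on_def)
    moreover have "(S ^^ n0) x \<in> N" using \<open>(S ^^ n0) x \<in> R n0\<close> x Rmono[of 0 n0] R0
      by (auto simp: N_def kernel_on_def)
    ultimately show "x \<in> kernel_on V (S ^^ n0)" using NR x by (auto simp: kernel_on_def)
  qed
  then show ?thesis by blast
qed

section \<open>Complex scalars and the dual space\<close>

lemma span_subset_cspan:
  fixes sm :: "complex \<Rightarrow> 'b::real_vector \<Rightarrow> 'b"
  assumes sm: "\<And>r v. sm (complex_of_real r) v = r *\<^sub>R v"
  shows "span A \<subseteq> cspan sm A"
proof
  fix x assume "x \<in> span A"
  then obtain F r where F: "finite F" "F \<subseteq> A" "x = (\<Sum>v\<in>F. r v *\<^sub>R v)"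
    unfolding span_explicit by blast
  then have "x = (\<Sum>v\<in>F. sm (complex_of_real (r v)) v)" by (simp add: sm)
  then show "x \<in> cspan sm A" unfolding cspan_def using F(1,2)
    by (intro CollectI exI[of _ F] exI[of _ "\<lambda>v. complex_of_real (r v)"]) simp
qed

text \<open>Complex multiples of \<open>v\<close> are real combinations of \<open>v\<close> and its
  multiple by the imaginary unit, so real generators are at most twice as many.\<close>

lemma cspan_subset_span:
  fixes sm :: "complex \<Rightarrow> 'b::real_vector \<Rightarrow> 'b"
  assumes sm: "\<And>c v. sm c v = Re c *\<^sub>R v + Im c *\<^sub>R sm \<i> v"
  shows "cspan sm A \<subseteq> span (A \<union> sm \<i> ` A)"
proof
  fix x assume "x \<in> cspan sm A"
  then obtain F c where F: "finite F" "F \<subseteq> A" "x = (\<Sum>v\<in>F. sm (c v) v)"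
    unfolding cspan_def by blast
  have "sm (c v) v \<in> span (A \<union> sm \<i> ` A)" if "v \<in> F" for v
    unfolding sm[of "c v"] using F(2) that by (intro span_add span_scale span_base) auto
  then show "x \<in> span (A \<union> sm \<i> ` A)" unfolding F(3) by (rule span_sum)
qed

lemma fin_dim_imp_span:
  fixes sm :: "complex \<Rightarrow> 'b::real_vector \<Rightarrow> 'b"
  assumes sm: "\<And>c v. sm c v = Re c *\<^sub>R v + Im c *\<^sub>R sm \<i> v" and "fin_dim sm A"
  obtains F where "finite F" "A \<subseteq> span F"
proof -
  obtain F where "finite F" "A \<subseteq> cspan sm F" using assms(2) by (auto simp: fin_dim_def)
  then show ?thesis using cspan_subset_span[of sm F, OF sm] that[of "F \<union> sm \<i> ` F"] by auto
qed

lemma fin_dim_if_span: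
  fixes sm :: "complex \<Rightarrow> 'b::real_vector \<Rightarrow> 'b"
  assumes sm: "\<And>r v. sm (complex_of_real r) v = r *\<^sub>R v" and "finite F" "A \<subseteq> span F"
  shows "fin_dim sm A"
proof -
  obtain G where "finite G" "G \<subseteq> A" "A \<subseteq> span G" using finite_spanning_subset[OF assms(3,2)] .
  then show ?thesis unfolding fin_dim_def using span_subset_cspan[of sm G, OF sm] by blast
qed

text \<open>The conclusion concerns supersets \<open>R\<close> stable under the imaginary unit,
  which absorb the multiples of elements of \<open>A\<close>; thus no linear structure of
  \<open>A\<close> has to be shown. One \<open>F\<close> serves all \<open>R\<close>, which is what
  bounds the codimensions of a whole sequence.\<close>

lemma fin_codim_imp_span:
  fixes sm :: "complex \<Rightarrow> 'b::real_vector \<Rightarrow> 'b"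
  assumes sm: "\<And>c v. sm c v = Re c *\<^sub>R v + Im c *\<^sub>R sm \<i> v" and A: "fin_codim sm V A"
  obtains F where "finite F" "\<And>R. A \<subseteq> R \<Longrightarrow> sm \<i> ` R \<subseteq> R \<Longrightarrow> V \<subseteq> span (R \<union> F)"
proof -
  obtain F where F: "finite F" "V \<subseteq> cspan sm (A \<union> F)" using A by (auto simp: fin_codim_def)
  show ?thesis
  proof (rule that[of "F \<union> sm \<i> ` F"])
    fix R assume R: "A \<subseteq> R" "sm \<i> ` R \<subseteq> R"
    have "V \<subseteq> span ((A \<union> F) \<union> sm \<i> ` (A \<union> F))" using F cspan_subset_span[of sm "A \<union> F", OF sm] by blast
    also have "\<dots> \<subseteq> span (R \<union> (F \<union> sm \<i> ` F))" using R by (intro span_mono) auto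
    finally show "V \<subseteq> span (R \<union> (F \<union> sm \<i> ` F))" .
  qed (use F in auto)
qed

lemma fin_codim_if_span:
  fixes sm :: "complex \<Rightarrow> 'b::real_vector \<Rightarrow> 'b"
  assumes sm: "\<And>r v. sm (complex_of_real r) v = r *\<^sub>R v"
    and F: "finite F" "F \<subseteq> V" "V \<subseteq> span (R \<union> F)" "R \<subseteq> A"
  shows "fin_codim sm V A"
proof -
  have "V \<subseteq> span (A \<union> F)" using F(3,4) span_mono[of "R \<union> F" "A \<union> F"] by auto
  then show ?thesis unfolding fin_codim_def using F(1,2) span_subset_cspan[of sm "A \<union> F", OF sm] by blast
qed

section \<open>Complex scalars in the space, its dual and the direct sum\<close>

lemma cscale_minus_one: "cscale (- 1) x = - x"
  using cscale_of_real[of "- 1" x] by simp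

lemma cscale_zero: "cscale c 0 = (0::'a::cbanach)"
  using cscale_add_right[of c "0::'a" 0] by simp

lemma cscale_scaleR: "cscale c (r *\<^sub>R x) = r *\<^sub>R cscale c x"
  unfolding cscale_of_real[symmetric] cscale_mult by (simp add: mult.commute)

lemma cscale_Re_Im: "cscale c x = Re c *\<^sub>R x + Im c *\<^sub>R cscale \<i> x"
  unfolding cscale_of_real[symmetric] cscale_mult cscale_add_left[symmetric]
  by (metis complex_eq mult.commute)

lemma bounded_linear_cscale: "bounded_linear (cscale c)"
  by (rule bounded_linear_intro[of _ "cmod c"])
    (auto simp: cscale_add_right cscale_scaleR norm_cscale mult.commute)

lemma dual_scale_apply: "blinfun_apply (dual_scale c f) x = c * blinfun_apply f x"
proof -
  have "bounded_linear (\<lambda>x. c * blinfun_apply f x)"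
    by (intro bounded_linear_compose[OF bounded_linear_mult_right] blinfun.bounded_linear_right)
  then show ?thesis by (simp add: dual_scale_def bounded_linear_Blinfun_apply)
qed

lemma dsum_scale_of_real: "dsum_scale (complex_of_real r) y = r *\<^sub>R y"
  by (auto simp: dsum_scale_def prod_eq_iff cscale_of_real dual_scale_apply blinfun.scaleR_left
      scaleR_conv_of_real intro!: blinfun_eqI)

lemma dsum_scale_Re_Im: "dsum_scale c y = Re c *\<^sub>R y + Im c *\<^sub>R dsum_scale \<i> y"
proof (rule prod_eqI)
  show "fst (dsum_scale c y) = fst (Re c *\<^sub>R y + Im c *\<^sub>R dsum_scale \<i> y)"
    using cscale_Re_Im[of c "fst y"] by (simp add: dsum_scale_def)
  have "c * z = Re c *\<^sub>R z + Im c *\<^sub>R (\<i> * z)" for z :: complex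
    by (simp add: complex_eq_iff)
  then show "snd (dsum_scale c y) = snd (Re c *\<^sub>R y + Im c *\<^sub>R dsum_scale \<i> y)"
    by (auto simp: dsum_scale_def dual_scale_apply blinfun.scaleR_left blinfun.add_left intro!: blinfun_eqI)
qed

lemma closed_dual_space: "closed (dual_space :: ('a::cbanach \<Rightarrow>\<^sub>L complex) set)"
proof -
  have eq: "dual_space = (\<Inter>c. \<Inter>x. {f :: 'a \<Rightarrow>\<^sub>L complex. blinfun_apply f (cscale c x) = c * blinfun_apply f x})"
    by (auto simp: dual_space_def)
  show ?thesis unfolding eq by (intro closed_INT ballI closed_Collect_eq continuous_intros)
qed

lemma subspace_dual_space: "subspace dual_space"
  by (auto simp: subspace_def dual_space_def blinfun.add_left blinfun.scaleR_left algebra_simps)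

lemma subspace_dsum_space: "subspace dsum_space"
  unfolding dsum_space_def by (intro subspace_Times subspace_UNIV subspace_dual_space)

text \<open>The standard complex-linear functional with real part \<open>h\<close>.\<close>

lemma complexify_functional:
  fixes h :: "'a::cbanach \<Rightarrow> real"
  assumes h: "bounded_linear h"
  obtains g where "g \<in> dual_space"
    "\<And>x. blinfun_apply g x = complex_of_real (h x) - \<i> * complex_of_real (h (cscale \<i> x))"
proof -
  define g0 where "g0 x = complex_of_real (h x) - \<i> * complex_of_real (h (cscale \<i> x))" for x
  have lh: "linear h" using h by (simp add: bounded_linear.linear)
  have "bounded_linear g0" unfolding g0_def
    by (intro bounded_linear_sub bounded_linear_compose[OF bounded_linear_of_real]
        bounded_linear_compose[OF bounded_linear_mult_right] h bounded_linear_compose[OF h] bounded_linear_cscale)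
  then have ap: "blinfun_apply (Blinfun g0) x = g0 x" for x by (simp add: bounded_linear_Blinfun_apply)
  have lg: "linear g0" using \<open>bounded_linear g0\<close> by (simp add: bounded_linear.linear)
  have gi: "g0 (cscale \<i> x) = \<i> * g0 x" for x
    by (simp add: g0_def cscale_mult cscale_minus_one linear_neg[OF lh] algebra_simps)
  have "g0 (cscale c x) = c * g0 x" for c x
  proof -
    have "g0 (cscale c x) = Re c *\<^sub>R g0 x + Im c *\<^sub>R (\<i> * g0 x)"
      unfolding cscale_Re_Im[of c x] linear_add[OF lg] linear_scale[OF lg] gi ..
    then show ?thesis by (simp add: complex_eq_iff)
  qed
  then have "Blinfun g0 \<in> dual_space" by (simp add: dual_space_def ap)
  then show ?thesis using that ap g0_def by metis
qed

text \<open>A real separating functional is complexified. Stability of \<open>M\<close> under the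
  imaginary unit makes both of its terms vanish on \<open>M\<close>.\<close>

lemma dual_separation:
  fixes M :: "'a::cbanach set"
  assumes M: "closed M" "subspace M" "\<And>x. x \<in> M \<Longrightarrow> cscale \<i> x \<in> M" and v: "v \<notin> M"
  obtains g where "g \<in> dual_space" "\<And>x. x \<in> M \<Longrightarrow> blinfun_apply g x = 0" "blinfun_apply g v \<noteq> 0"
proof -
  obtain h :: "'a \<Rightarrow> real" where h: "bounded_linear h" "\<And>x. x \<in> M \<Longrightarrow> h x = 0" "h v \<noteq> 0"
    using separate_point_closed_subspace[OF M(1,2) v] by metis
  obtain g where g: "g \<in> dual_space"
    "\<And>x. blinfun_apply g x = complex_of_real (h x) - \<i> * complex_of_real (h (cscale \<i> x))"
    using complexify_functional[OF h(1)] by metis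
  show ?thesis by (rule that[OF g(1)]) (use g(2) h M(3) in \<open>auto simp: complex_eq_iff\<close>)
qed

text \<open>Composition with \<open>A\<close>, which is taken to be \<open>T - mu\<close>, so that
  powers of \<open>adj A\<close> are transposes of powers of \<open>A\<close>.
  \<open>Blinfun A\<close> has its meaning only for bounded linear \<open>A\<close>.\<close>

definition adj :: "('a::cbanach \<Rightarrow> 'a) \<Rightarrow> ('a \<Rightarrow>\<^sub>L complex) \<Rightarrow> ('a \<Rightarrow>\<^sub>L complex)"
  where "adj A f = f o\<^sub>L Blinfun A"

lemma adj_apply: "bounded_linear A \<Longrightarrow> blinfun_apply (adj A f) x = blinfun_apply f (A x)"
  by (simp add: adj_def bounded_linear_Blinfun_apply)

lemma bounded_linear_adj: "bounded_linear (adj A)"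
  unfolding adj_def by (rule bounded_bilinear.bounded_linear_left[OF bounded_bilinear_blinfun_compose])

lemma adj_funpow_apply:
  assumes A: "bounded_linear A"
  shows "blinfun_apply ((adj A ^^ n) f) x = blinfun_apply f ((A ^^ n) x)"
  by (induction n arbitrary: f x) (simp_all add: adj_apply[OF A] funpow_swap1)

lemma clinear_op_funpow:
  fixes A :: "'a::cbanach \<Rightarrow> 'a"
  assumes "clinear_op A"
  shows "clinear_op (A ^^ n)"
proof -
  have "(A ^^ n) (cscale c x) = cscale c ((A ^^ n) x)" for c x
    by (induction n) (use assms in \<open>auto simp: clinear_op_def\<close>)
  then show ?thesis using assms bounded_linear_funpow by (auto simp: clinear_op_def)
qed

lemma adj_mem_dual_space: "clinear_op A \<Longrightarrow> f \<in> dual_space \<Longrightarrow> adj A f \<in> dual_space"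
  by (auto simp: dual_space_def clinear_op_def adj_apply)

lemma adj_funpow_mem_dual_space: "clinear_op A \<Longrightarrow> f \<in> dual_space \<Longrightarrow> (adj A ^^ n) f \<in> dual_space"
  by (induction n) (auto simp: adj_mem_dual_space)

text \<open>The part of the closed range theorem that is needed for powers. If \<open>f\<close>
  vanishes on the kernel of \<open>A ^^ n\<close>, the open mapping theorem bounds preimages under
  this power, so the real part of \<open>f\<close> factors through it; the factor is then
  complexified. As annihilators are closed, so are these ranges.\<close>

lemma adj_range_eq_annihilator:
  fixes A :: "'a::cbanach \<Rightarrow> 'a"
  assumes A: "clinear_op A" and cl: "closed (range (A ^^ n))"
  shows "(adj A ^^ n) ` dual_space = {f \<in> dual_space. \<forall>x. (A ^^ n) x = 0 \<longrightarrow> blinfun_apply f x = 0}"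
proof (intro equalityI subsetI)
  have bA: "bounded_linear A" using A by (simp add: clinear_op_def)
  fix f assume "f \<in> (adj A ^^ n) ` dual_space"
  then show "f \<in> {f \<in> dual_space. \<forall>x. (A ^^ n) x = 0 \<longrightarrow> blinfun_apply f x = 0}"
    using adj_funpow_mem_dual_space[OF A] by (auto simp: adj_funpow_apply[OF bA])
next
  have bA: "bounded_linear A" using A by (simp add: clinear_op_def)
  define B where "B = A ^^ n"
  have B: "clinear_op B" unfolding B_def by (rule clinear_op_funpow[OF A])
  then have bB: "bounded_linear B" by (simp add: clinear_op_def)
  then have lB: "linear B" by (simp add: bounded_linear.linear)
  fix f assume f: "f \<in> {f \<in> dual_space. \<forall>x. (A ^^ n) x = 0 \<longrightarrow> blinfun_apply f x = 0}"
  obtain C where C: "\<And>y. y \<in> range B \<Longrightarrow> \<exists>x\<in>UNIV. B x = y \<and> norm x \<le> C * norm y"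
    using open_mapping_closed_subspaces[OF bB closed_UNIV subspace_UNIV, of "range B"] cl
      linear_subspace_image[OF lB subspace_UNIV] unfolding B_def by blast
  have bf: "bounded_linear (\<lambda>x. Re (blinfun_apply f x))"
    by (intro bounded_linear_compose[OF bounded_linear_Re] blinfun.bounded_linear_right)
  obtain h where h: "bounded_linear h" "\<And>x. h (B x) = Re (blinfun_apply f x)"
  proof (rule factor_functional_through_operator[OF lB bf])
    show "Re (blinfun_apply f x) = 0" if "B x = 0" for x using f that by (auto simp: B_def)
    show "\<exists>x'. B x' = B x \<and> norm x' \<le> C * norm (B x)" for x using C[of "B x"] by blast
  qed blast
  obtain g where g: "g \<in> dual_space"
    "\<And>x. blinfun_apply g x = complex_of_real (h x) - \<i> * complex_of_real (h (cscale \<i> x))"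
    using complexify_functional[OF h(1)] by metis
  \<comment> \<open>A complex-linear functional is recovered from its real part, since the real part
    at the \<open>cscale\<close> multiple of \<open>x\<close> by the imaginary unit is minus the
    imaginary part at \<open>x\<close>.\<close>
  have "blinfun_apply g (B x) = blinfun_apply f x" for x
  proof -
    have "cscale \<i> (B x) = B (cscale \<i> x)" using B by (simp add: clinear_op_def)
    then have "blinfun_apply g (B x)
        = complex_of_real (Re (blinfun_apply f x)) - \<i> * complex_of_real (Re (blinfun_apply f (cscale \<i> x)))"
      by (simp add: g(2) h(2))
    moreover have "blinfun_apply f (cscale \<i> x) = \<i> * blinfun_apply f x" using f by (auto simp: dual_space_def)
    ultimately show ?thesis by (simp add: complex_eq_iff)
  qed
  then have "(adj A ^^ n) g = f" by (intro blinfun_eqI) (simp add: adj_funpow_apply[OF bA] B_def)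
  then show "f \<in> (adj A ^^ n) ` dual_space" using g(1) by blast
qed

lemma closed_annihilator:
  fixes N :: "'a::cbanach set"
  shows "closed {f \<in> dual_space. \<forall>x\<in>N. blinfun_apply f x = 0}"
proof -
  have "{f \<in> dual_space. \<forall>x\<in>N. blinfun_apply f x = 0}
      = dual_space \<inter> (\<Inter>x\<in>N. {f. blinfun_apply f x = 0})" by auto
  moreover have "closed {f :: 'a \<Rightarrow>\<^sub>L complex. blinfun_apply f x = 0}" for x
    by (intro closed_Collect_eq continuous_intros)
  ultimately show ?thesis by (auto intro!: closed_Int closed_dual_space)
qed

text \<open>Vanishing at one more point \<open>v\<close> is the kernel of an evaluation with values
  in the finite-dimensional space of complex numbers, so each point costs finitely many
  generators.\<close>

lemma finite_codim_annihilator: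
  fixes W :: "('a::real_normed_vector \<Rightarrow>\<^sub>L complex) set"
  assumes "finite F" and W: "subspace W"
  shows "\<exists>G. finite G \<and> G \<subseteq> W \<and> W \<subseteq> span ({f \<in> W. \<forall>v\<in>F. blinfun_apply f v = 0} \<union> G)"
  using assms(1)
proof (induction F)
  case empty
  show ?case using span_superset[of W] by (intro exI[of _ "{}"]) auto
next
  case (insert v F)
  then obtain G where G: "finite G" "G \<subseteq> W" "W \<subseteq> span ({f \<in> W. \<forall>v\<in>F. blinfun_apply f v = 0} \<union> G)" by blast
  define U where "U = {f \<in> W. \<forall>v\<in>F. blinfun_apply f v = 0}"
  have U: "subspace U" unfolding U_def using W
    by (auto simp: subspace_def blinfun.add_left blinfun.scaleR_left)
  have lin: "linear (\<lambda>f :: 'a \<Rightarrow>\<^sub>L complex. blinfun_apply f v)"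
    by (rule linearI) (auto simp: blinfun.add_left blinfun.scaleR_left)
  obtain H where H: "finite H" "H \<subseteq> U" "U \<subseteq> span ({f \<in> U. blinfun_apply f v = 0} \<union> H)"
    using span_kernel_Un_finite[OF lin U, of Basis] by (auto simp: span_Basis)
  have eq: "{f \<in> U. blinfun_apply f v = 0} = {f \<in> W. \<forall>v\<in>insert v F. blinfun_apply f v = 0}" by (auto simp: U_def)
  let ?S = "{f \<in> W. \<forall>v\<in>insert v F. blinfun_apply f v = 0} \<union> (G \<union> H)"
  have "U \<subseteq> span ?S" using H(3) span_mono[of "{f \<in> U. blinfun_apply f v = 0} \<union> H" ?S] unfolding eq by auto
  moreover have "G \<subseteq> span ?S" using span_superset[of ?S] by auto
  ultimately have "span (U \<union> G) \<subseteq> span ?S" by (intro span_minimal) auto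
  then show ?case using G H by (intro exI[of _ "G \<union> H"]) (auto simp: U_def)
qed

section \<open>Ascent, descent and Fredholm operators\<close>

text \<open>\<open>A\<close> maps the kernel of \<open>A ^^ Suc n\<close> into that of
  \<open>A ^^ n\<close>, and the kernel of this restriction lies in the kernel of
  \<open>A\<close>.\<close>

lemma finite_dim_kernel_funpow:
  fixes A :: "'a::real_vector \<Rightarrow> 'a"
  assumes A: "linear A" and K: "finite K" "kernel_on UNIV A \<subseteq> span K"
  shows "\<exists>F. finite F \<and> kernel_on UNIV (A ^^ n) \<subseteq> span F"
proof (induction n)
  case 0
  show ?case by (intro exI[of _ "{}"]) (auto simp: kernel_on_def)
next
  case (Suc n)
  then obtain F where F: "finite F" "kernel_on UNIV (A ^^ n) \<subseteq> span F" by blast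
  have "(A ^^ m) 0 = 0 \<and> (A ^^ m) (x + y) = (A ^^ m) x + (A ^^ m) y \<and> (A ^^ m) (c *\<^sub>R x) = c *\<^sub>R (A ^^ m) x" for m x y c
    by (induction m) (auto simp: linear_0[OF A] linear_add[OF A] linear_scale[OF A])
  then have s: "subspace (kernel_on UNIV (A ^^ Suc n))"
    unfolding kernel_on_def by (intro subspaceI) (simp_all del: funpow.simps)
  have "A ` kernel_on UNIV (A ^^ Suc n) \<subseteq> span F" using F(2) by (auto simp: kernel_on_def funpow_swap1)
  moreover have "{w \<in> kernel_on UNIV (A ^^ Suc n). A w = 0} \<subseteq> span K" using K(2) by (auto simp: kernel_on_def)
  ultimately obtain F' where "finite F'" "kernel_on UNIV (A ^^ Suc n) \<subseteq> span F'"
    by (rule finite_dim_if_kernel_and_image[OF A s _ F(1) _ K(1)])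
  then show ?case by blast
qed

lemma finite_codim_range_funpow:
  fixes A :: "'a::real_vector \<Rightarrow> 'a"
  assumes A: "linear A" and G: "finite G" "span (range A \<union> G) = UNIV"
  shows "\<exists>F. finite F \<and> span (range (A ^^ n) \<union> F) = UNIV"
proof (induction n)
  case 0
  show ?case by (intro exI[of _ "{}"]) (auto simp: id_def)
next
  case (Suc n)
  then obtain F where F: "finite F" "span (range (A ^^ n) \<union> F) = UNIV" by blast
  let ?S = "range (A ^^ Suc n) \<union> (A ` F \<union> G)"
  have "range A = span (A ` (range (A ^^ n) \<union> F))"
    using linear_span_image[OF A, of "range (A ^^ n) \<union> F"] F(2) by simp
  also have "\<dots> \<subseteq> span ?S" by (intro span_mono) auto
  finally have "range A \<union> G \<subseteq> span ?S" using span_superset[of ?S] by auto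
  then have "span (range A \<union> G) \<subseteq> span ?S" by (intro span_minimal) auto
  then show ?case using G F(1) by (intro exI[of _ "A ` F \<union> G"]) auto
qed

text \<open>The Fredholm data in real terms, for all powers; closed ranges follow from finite
  codimension.\<close>

lemma fredholm_funpow:
  fixes A :: "'a::cbanach \<Rightarrow> 'a"
  assumes A: "clinear_op A" and fr: "fredholm A"
  shows "\<exists>F. finite F \<and> kernel_on UNIV (A ^^ n) \<subseteq> span F"
    and "\<exists>F. finite F \<and> span (range (A ^^ n) \<union> F) = UNIV"
    and "closed (range (A ^^ n))"
proof -
  have bA: "bounded_linear A" using A by (simp add: clinear_op_def)
  then have lA: "linear A" by (simp add: bounded_linear.linear)
  obtain K where K: "finite K" "kernel_on UNIV A \<subseteq> span K"
    using fin_dim_imp_span[of cscale, OF cscale_Re_Im] fr by (metis fredholm_def)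
  obtain G where G: "finite G" "\<And>R. range A \<subseteq> R \<Longrightarrow> cscale \<i> ` R \<subseteq> R \<Longrightarrow> UNIV \<subseteq> span (R \<union> G)"
    using fin_codim_imp_span[of cscale UNIV "range A", OF cscale_Re_Im] fr by (metis fredholm_def)
  have "cscale \<i> (A x) = A (cscale \<i> x)" for x using A by (simp add: clinear_op_def)
  then have "span (range A \<union> G) = UNIV" using G(2)[of "range A"] by auto
  then show cod: "\<exists>F. finite F \<and> span (range (A ^^ n) \<union> F) = UNIV"
    by (rule finite_codim_range_funpow[OF lA G(1)])
  show "\<exists>F. finite F \<and> kernel_on UNIV (A ^^ n) \<subseteq> span F"
    by (rule finite_dim_kernel_funpow[OF lA K])
  show "closed (range (A ^^ n))"
    using cod closed_range_finite_codim[OF bounded_linear_funpow[OF bA]] by blast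
qed

lemma kernel_funpow_stable:
  assumes "kernel_on UNIV (A ^^ n) = kernel_on UNIV (A ^^ Suc n)" "n \<le> m"
  shows "kernel_on UNIV (A ^^ m) = kernel_on UNIV (A ^^ n)"
  using assms(2)
proof (induction m rule: dec_induct)
  case (step m)
  have "(A ^^ Suc m) x = 0 \<longleftrightarrow> (A ^^ m) x = 0" for x
  proof -
    have m: "m = n + (m - n)" using step by simp
    have "(A ^^ Suc m) x = (A ^^ Suc n) ((A ^^ (m - n)) x)" "(A ^^ m) x = (A ^^ n) ((A ^^ (m - n)) x)"
      by (subst m, simp add: funpow_add)+
    then show ?thesis using assms(1) by (auto simp: kernel_on_def set_eq_iff)
  qed
  then show ?case using step by (simp add: kernel_on_def)
qed simp

lemma range_funpow_stable:
  fixes A :: "'a \<Rightarrow> 'a"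
  assumes "range (A ^^ n) = range (A ^^ Suc n)" "n \<le> m"
  shows "range (A ^^ m) = range (A ^^ n)"
  using assms(2)
proof (induction m rule: dec_induct)
  case (step m)
  have "range (A ^^ Suc m) = A ` range (A ^^ m)" by (auto simp: image_image)
  also have "\<dots> = range (A ^^ Suc n)" using step by (auto simp: image_image)
  finally show ?case using assms(1) by simp
qed simp

text \<open>For \<open>n\<close> beyond the stationary indices, \<open>(A ^^ n) x\<close> is of the
  form \<open>(A ^^ (n + n)) z\<close>, so \<open>x\<close> is the sum of the kernel element
  \<open>x - (A ^^ n) z\<close> and a range element.\<close>

lemma ascent_descent_decomposition:
  fixes A :: "'a::cbanach \<Rightarrow> 'a"
  assumes A: "linear A" and fin: "finite_ascent A" "finite_descent A"
  obtains n where "n > 0" "ascent A \<le> n" "A ` range (A ^^ n) = range (A ^^ n)"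
    "\<And>m. ascent A \<le> m \<Longrightarrow> kernel_on UNIV (A ^^ m) = kernel_on UNIV (A ^^ ascent A)"
    "range (A ^^ ascent A) = range (A ^^ n)"
    "\<And>x. \<exists>z. (A ^^ n) (x - (A ^^ n) z) = 0"
proof -
  define p where "p = ascent A"
  have "kernel_on UNIV (A ^^ p) = kernel_on UNIV (A ^^ Suc p)"
    unfolding p_def ascent_def using fin(1) unfolding finite_ascent_def by (rule LeastI_ex)
  then have ker: "kernel_on UNIV (A ^^ m) = kernel_on UNIV (A ^^ p)" if "p \<le> m" for m
    using kernel_funpow_stable that by blast
  obtain q where "range (A ^^ q) = range (A ^^ Suc q)" using fin(2) by (auto simp: finite_descent_def)
  then have ran: "range (A ^^ m) = range (A ^^ q)" if "q \<le> m" for m using range_funpow_stable that by blast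
  \<comment> \<open>The successor makes \<open>n\<close> positive, so that the range of
    \<open>A ^^ n\<close> lies in that of \<open>A\<close>.\<close>
  define n where "n = Suc (max p q)"
  have qn: "q \<le> n" by (simp add: n_def)
  have lin: "linear (A ^^ k)" for k
    by (induction k) (auto simp: id_def o_def linear_ident linear_compose[OF _ A, unfolded o_def])
  have dec: "\<exists>z. (A ^^ n) (x - (A ^^ n) z) = 0" for x
  proof -
    have "range (A ^^ n) = range (A ^^ (n + n))" using ran[of n] ran[of "n + n"] qn by simp
    then have "(A ^^ n) x \<in> range (A ^^ (n + n))" by blast
    then obtain z where "(A ^^ n) x = (A ^^ n) ((A ^^ n) z)" by (auto simp: funpow_add)
    then show ?thesis by (auto simp: linear_diff[OF lin])
  qed
  \<comment> \<open>The ranges are stationary from the ascent \<open>p\<close> on: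
    \<open>A ^^ p\<close> kills the kernel part of \<open>y\<close> and maps the range part back
    into the range of \<open>A ^^ n\<close>.\<close>
  have pn: "range (A ^^ p) \<subseteq> range (A ^^ n)"
  proof clarify
    fix y
    obtain z where "(A ^^ n) (y - (A ^^ n) z) = 0" using dec by blast
    then have "(A ^^ p) (y - (A ^^ n) z) = 0" using ker[of n] by (auto simp: kernel_on_def n_def set_eq_iff)
    then have "(A ^^ p) y = (A ^^ p) ((A ^^ n) z)" by (simp add: linear_diff[OF lin])
    also have "\<dots> = (A ^^ n) ((A ^^ p) z)" by (metis add.commute comp_apply funpow_add)
    finally show "(A ^^ p) y \<in> range (A ^^ n)" by simp
  qed
  have np: "range (A ^^ n) \<subseteq> range (A ^^ p)"
  proof clarify
    fix y
    have "n = p + (n - p)" by (simp add: n_def)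
    then have "(A ^^ n) y = (A ^^ p) ((A ^^ (n - p)) y)" by (metis comp_apply funpow_add)
    then show "(A ^^ n) y \<in> range (A ^^ p)" by simp
  qed
  have "A ` range (A ^^ n) = range (A ^^ Suc n)" by (auto simp: image_image)
  then have An: "A ` range (A ^^ n) = range (A ^^ n)" using ran[of n] ran[of "Suc n"] qn by (simp del: funpow.simps)
  show ?thesis
  proof (rule that[of n])
    show "0 < n" "ascent A \<le> n" unfolding p_def[symmetric] by (simp_all add: n_def)
    show "range (A ^^ ascent A) = range (A ^^ n)"
      unfolding p_def[symmetric] using pn np by (rule subset_antisym)
    show "kernel_on UNIV (A ^^ m) = kernel_on UNIV (A ^^ ascent A)" if "ascent A \<le> m" for m
      unfolding p_def[symmetric] using that by (intro ker) (simp add: p_def)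
  qed (fact An dec)+
qed

section \<open>The operator on the direct sum\<close>

lemma funpow_cong_on:
  assumes "\<And>y. y \<in> V \<Longrightarrow> S y = P y \<and> P y \<in> V" "x \<in> V"
  shows "(S ^^ n) x = (P ^^ n) x \<and> (P ^^ n) x \<in> V"
  by (induction n) (use assms in auto)

text \<open>Needed because \<open>dsum_shift\<close> and the sum of \<open>A\<close> and
  \<open>adj A\<close> are compared only on \<open>dsum_space\<close>: outside the dual, multiplying
  values by \<open>mu\<close> need not equal composing with \<open>cscale mu\<close>.\<close>

lemma H0_kernel_Kcore_cong:
  assumes "\<And>y. y \<in> V \<Longrightarrow> S y = P y \<and> P y \<in> V"
  shows "H0 V S = H0 V P" "kernel_on V (S ^^ n) = kernel_on V (P ^^ n)" "Kcore V S = Kcore V P"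
proof -
  note eq = funpow_cong_on[of V S P, OF assms]
  show "H0 V S = H0 V P" unfolding H0_def using eq by (auto cong: conj_cong)
  show "kernel_on V (S ^^ n) = kernel_on V (P ^^ n)" unfolding kernel_on_def using eq by auto
  have "(\<forall>n. u n \<in> V \<and> S (u (Suc n)) = u n \<and> norm (u n) \<le> c ^ n * a)
      \<longleftrightarrow> (\<forall>n. u n \<in> V \<and> P (u (Suc n)) = u n \<and> norm (u n) \<le> c ^ n * a)" for u c a
    using assms by metis
  then show "Kcore V S = Kcore V P" unfolding Kcore_def by simp
qed

definition adj_sum :: "('a::cbanach \<Rightarrow> 'a) \<Rightarrow> 'a \<times> ('a \<Rightarrow>\<^sub>L complex) \<Rightarrow> 'a \<times> ('a \<Rightarrow>\<^sub>L complex)"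
  where "adj_sum A y = (A (fst y), adj A (snd y))"

lemma adj_sum_funpow: "(adj_sum A ^^ n) y = ((A ^^ n) (fst y), (adj A ^^ n) (snd y))"
  by (induction n) (auto simp: adj_sum_def)

lemma bounded_linear_adj_sum: "bounded_linear A \<Longrightarrow> bounded_linear (adj_sum A)"
  unfolding adj_sum_def
  by (intro bounded_linear_Pair bounded_linear_compose[OF bounded_linear_adj bounded_linear_snd]
      bounded_linear_compose[OF _ bounded_linear_fst])

lemma adj_sum_mem_dsum_space: "clinear_op A \<Longrightarrow> y \<in> dsum_space \<Longrightarrow> adj_sum A y \<in> dsum_space"
  by (auto simp: dsum_space_def adj_sum_def adj_mem_dual_space)

lemma clinear_op_shift:
  assumes "\<forall>c x. blinfun_apply T (cscale c x) = cscale c (blinfun_apply T x)"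
  shows "clinear_op (shift T \<mu>)"
proof -
  have "bounded_linear (shift T \<mu>)" unfolding shift_def
    by (intro bounded_linear_sub blinfun.bounded_linear_right bounded_linear_cscale)
  moreover have "shift T \<mu> (cscale c x) = cscale c (shift T \<mu> x)" for c x
  proof -
    have "cscale c (blinfun_apply T x - cscale \<mu> x) = cscale c (blinfun_apply T x) - cscale c (cscale \<mu> x)"
      by (rule linear_diff[OF bounded_linear.linear[OF bounded_linear_cscale]])
    then show ?thesis using assms by (simp add: shift_def cscale_mult mult.commute)
  qed
  ultimately show ?thesis by (simp add: clinear_op_def)
qed

lemma dsum_shift_eq_adj_sum:
  assumes T: "\<forall>c x. blinfun_apply T (cscale c x) = cscale c (blinfun_apply T x)" and y: "y \<in> dsum_space"
  shows "dsum_shift T \<mu> y = adj_sum (shift T \<mu>) y"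
proof (rule prod_eqI)
  show "fst (dsum_shift T \<mu> y) = fst (adj_sum (shift T \<mu>) y)"
    by (simp add: dsum_shift_def dsum_scale_def adj_sum_def shift_def)
  have b: "bounded_linear (shift T \<mu>)" using clinear_op_shift[OF T] by (simp add: clinear_op_def)
  have d: "blinfun_apply (snd y) (cscale \<mu> x) = \<mu> * blinfun_apply (snd y) x" for x
    using y by (auto simp: dsum_space_def dual_space_def)
  show "snd (dsum_shift T \<mu> y) = snd (adj_sum (shift T \<mu>) y)"
  proof (rule blinfun_eqI)
    fix x
    have "blinfun_apply (snd (adj_sum (shift T \<mu>) y)) x = blinfun_apply (snd y) (shift T \<mu> x)"
      by (simp add: adj_sum_def adj_apply[OF b])
    then show "blinfun_apply (snd (dsum_shift T \<mu> y)) x = blinfun_apply (snd (adj_sum (shift T \<mu>) y)) x"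
      by (simp add: dsum_shift_def dsum_scale_def dual_op_def blinfun.diff_left dual_scale_apply
          shift_def blinfun.diff_right d)
  qed
qed

lemma le_zero_if_le_geometric:
  fixes a D :: real
  assumes "\<And>k. a \<le> D * (1/2) ^ k"
  shows "a \<le> 0"
proof -
  have "(\<lambda>k. D * (1/2) ^ k) \<longlonglongrightarrow> 0" by (intro tendsto_mult_right_zero LIMSEQ_power_zero) simp
  then show ?thesis using assms by (intro LIMSEQ_le_const) auto
qed

lemma mem_H0_adj_sum:
  assumes "y \<in> H0 dsum_space (adj_sum A)"
  shows "fst y \<in> H0 UNIV A" "snd y \<in> H0 dual_space (adj A)"
proof -
  have "norm ((A ^^ n) (fst y)) \<le> norm ((adj_sum A ^^ n) y)"
    "norm ((adj A ^^ n) (snd y)) \<le> norm ((adj_sum A ^^ n) y)" for n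
    by (simp_all add: adj_sum_funpow norm_fst_le norm_snd_le)
  then show "fst y \<in> H0 UNIV A" "snd y \<in> H0 dual_space (adj A)"
    using assms unfolding mem_H0_iff dsum_space_def by (auto intro: order_trans) (meson order_trans)+
qed

text \<open>Written as preimages under continuous embeddings, so that closedness passes from the sum
  to both summands.\<close>

lemma H0_eq_vimage_adj_sum:
  assumes A: "linear A"
  shows "H0 UNIV A = (\<lambda>x. (x, 0)) -` H0 dsum_space (adj_sum A)"
    and "H0 dual_space (adj A) = (\<lambda>f. (0, f)) -` H0 dsum_space (adj_sum A)"
proof -
  have a0: "(A ^^ n) 0 = 0" for n by (induction n) (auto simp: linear_0[OF A])
  have d0: "(adj A ^^ n) 0 = 0" for n
    by (induction n) (auto simp: linear_0[OF bounded_linear.linear[OF bounded_linear_adj]])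
  show "H0 UNIV A = (\<lambda>x. (x, 0)) -` H0 dsum_space (adj_sum A)"
    by (auto simp: mem_H0_iff adj_sum_funpow d0 dsum_space_def subspace_0[OF subspace_dual_space])
  show "H0 dual_space (adj A) = (\<lambda>f. (0, f)) -` H0 dsum_space (adj_sum A)"
    by (auto simp: mem_H0_iff adj_sum_funpow a0 dsum_space_def)
qed

text \<open>With \<open>R\<close> the stable range, \<open>A\<close> is injective on
  \<open>R\<close> and its inverse powers grow at most like \<open>C ^ k\<close>; a quasinilpotent
  component in \<open>R\<close> is therefore 0. Likewise a quasinilpotent functional vanishes on
  \<open>R\<close>, which is the range of \<open>A ^^ ascent A\<close>.\<close>

lemma H0_adj_sum_eq_kernel:
  fixes A :: "'a::cbanach \<Rightarrow> 'a"
  assumes A: "clinear_op A" and fr: "fredholm A" and fin: "finite_ascent A" "finite_descent A"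
  shows "H0 dsum_space (adj_sum A) = kernel_on dsum_space (adj_sum A ^^ ascent A)"
proof
  have bA: "bounded_linear A" using A by (simp add: clinear_op_def)
  then have lA: "linear A" by (simp add: bounded_linear.linear)
  have lin: "linear (A ^^ n)" for n using bounded_linear_funpow[OF bA] bounded_linear.linear by blast
  show "kernel_on dsum_space (adj_sum A ^^ ascent A) \<subseteq> H0 dsum_space (adj_sum A)"
    using kernel_funpow_subset_H0 bounded_linear_adj_sum[OF bA] bounded_linear.linear by blast
  obtain n where n: "n > 0" "ascent A \<le> n" "A ` range (A ^^ n) = range (A ^^ n)"
    and ker: "\<And>m. ascent A \<le> m \<Longrightarrow> kernel_on UNIV (A ^^ m) = kernel_on UNIV (A ^^ ascent A)"
    and ran: "range (A ^^ ascent A) = range (A ^^ n)"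
    and dec: "\<And>x. \<exists>z. (A ^^ n) (x - (A ^^ n) z) = 0"
    using ascent_descent_decomposition[OF lA fin] by blast
  define R where "R = range (A ^^ n)"
  have R: "closed R" "subspace R" "A ` R = R"
    unfolding R_def using fredholm_funpow(3)[OF A fr] linear_subspace_image[OF lin subspace_UNIV] n(3) by auto
  obtain C where C: "C > 0" "\<And>x k. x \<in> R \<Longrightarrow> \<exists>z\<in>R. (A ^^ k) z = x \<and> norm z \<le> C ^ k * norm x"
    using iterated_preimage_bound[OF bA R] by metis
  define e where "e = 1 / (2 * C)"
  have e: "e > 0" "C ^ k * e ^ k = (1/2) ^ k" for k
    using C(1) by (simp_all add: e_def flip: power_mult_distrib)
  show "H0 dsum_space (adj_sum A) \<subseteq> kernel_on dsum_space (adj_sum A ^^ ascent A)"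
  proof
    fix y assume y: "y \<in> H0 dsum_space (adj_sum A)"
    define x f where "x = fst y" and "f = snd y"
    have x: "x \<in> H0 UNIV A" and f: "f \<in> H0 dual_space (adj A)"
      using mem_H0_adj_sum[OF y] by (simp_all add: x_def f_def)
    obtain z where z: "(A ^^ n) (x - (A ^^ n) z) = 0" using dec by blast
    define w where "w = (A ^^ n) z"
    have wR: "w \<in> R" by (simp add: w_def R_def)
    have "x - w \<in> H0 UNIV A"
      using kernel_funpow_subset_H0[OF lA, of UNIV n] z by (auto simp: w_def kernel_on_def)
    then have "w \<in> H0 UNIV A"
      using x subspace_diff[OF subspace_H0[OF subspace_UNIV lA], of x "x - w"] by simp
    then obtain D where D: "\<And>k. norm ((A ^^ k) w) \<le> D * e ^ k" using e(1) unfolding mem_H0_iff by blast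
    have "norm w \<le> D * (1/2) ^ k" for k
    proof -
      have "(A ^^ k) w \<in> R" using wR R(3) by (induction k) auto
      then obtain v where v: "v \<in> R" "(A ^^ k) v = (A ^^ k) w" "norm v \<le> C ^ k * norm ((A ^^ k) w)"
        using C(2) by blast
      \<comment> \<open>This is injectivity on \<open>R\<close>: the difference \<open>w - v\<close>
        lies in the range of \<open>A ^^ n\<close> and is killed by \<open>A ^^ k\<close>, so
        \<open>s\<close> is in the kernel of \<open>A ^^ (k + n)\<close>, which equals that of
        \<open>A ^^ n\<close>.\<close>
      obtain s where s: "w - v = (A ^^ n) s" using wR v(1) R(2) unfolding R_def
        by (metis (no_types, lifting) imageE subspace_diff)
      have "(A ^^ (k + n)) s = 0" using v(2) by (simp add: funpow_add linear_diff[OF lin] flip: s)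
      then have "(A ^^ n) s = 0" using ker[of n] ker[of "k + n"] n(2) by (auto simp: kernel_on_def set_eq_iff)
      then have "v = w" using s by simp
      then have "norm w \<le> C ^ k * norm ((A ^^ k) w)" using v(3) by simp
      also have "\<dots> \<le> C ^ k * (D * e ^ k)" using D C(1) by (intro mult_left_mono) auto
      also have "\<dots> = D * (1/2) ^ k" unfolding e(2)[symmetric] by simp
      finally show ?thesis .
    qed
    then have "w = 0" using le_zero_if_le_geometric by fastforce
    then have "x \<in> kernel_on UNIV (A ^^ n)" using z by (simp add: w_def kernel_on_def)
    then have "x \<in> kernel_on UNIV (A ^^ ascent A)" using ker[OF n(2)] by simp
    then have xp: "(A ^^ ascent A) x = 0" by (simp add: kernel_on_def)
    obtain E where E: "\<And>k. norm ((adj A ^^ k) f) \<le> E * e ^ k" using f e(1) unfolding mem_H0_iff by blast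
    \<comment> \<open>The value \<open>f r\<close> equals that of \<open>(adj A ^^ k) f\<close> at a
      \<open>k\<close>-fold preimage of \<open>r\<close>; decay at rate \<open>e\<close> beats
      growth at rate \<open>C\<close>.\<close>
    have f0: "blinfun_apply f r = 0" if r: "r \<in> R" for r
    proof -
      have "norm (blinfun_apply f r) \<le> (E * norm r) * (1/2) ^ k" for k
      proof -
        obtain v where v: "(A ^^ k) v = r" "norm v \<le> C ^ k * norm r" using C(2)[OF r] by blast
        have E0: "0 \<le> E * e ^ k" using E[of k] norm_ge_zero order_trans by blast
        have "norm (blinfun_apply f r) = norm (blinfun_apply ((adj A ^^ k) f) v)"
          by (simp add: adj_funpow_apply[OF bA] v)
        also have "\<dots> \<le> norm ((adj A ^^ k) f) * norm v" by (rule norm_blinfun)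
        also have "\<dots> \<le> (E * e ^ k) * (C ^ k * norm r)" using E v E0 by (intro mult_mono) auto
        also have "\<dots> = (E * norm r) * (1/2) ^ k" unfolding e(2)[symmetric] by simp
        finally show ?thesis .
      qed
      then have "norm (blinfun_apply f r) \<le> 0" by (rule le_zero_if_le_geometric)
      then show ?thesis by simp
    qed
    have "(A ^^ ascent A) v \<in> R" for v using ran by (auto simp: R_def)
    then have "(adj A ^^ ascent A) f = 0" by (intro blinfun_eqI) (simp add: adj_funpow_apply[OF bA] f0)
    then have "(adj_sum A ^^ ascent A) y = 0" using xp by (simp add: adj_sum_funpow x_def f_def zero_prod_def)
    then show "y \<in> kernel_on dsum_space (adj_sum A ^^ ascent A)"
      using y by (simp add: kernel_on_def mem_H0_iff)
  qed
qed

text \<open>A functional that vanishes on \<open>R\<close> is determined by its values on the finite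
  set \<open>F\<close>.\<close>

lemma finite_dim_annihilator:
  fixes R :: "'a::cbanach set"
  assumes F: "finite F" "span (R \<union> F) = UNIV"
  shows "\<exists>G. finite G \<and> {f \<in> dual_space. \<forall>x\<in>R. blinfun_apply f x = 0} \<subseteq> span G"
proof -
  define W where "W = {f :: 'a \<Rightarrow>\<^sub>L complex. f \<in> dual_space \<and> (\<forall>x\<in>R. blinfun_apply f x = 0)}"
  have "subspace W" unfolding W_def using subspace_dual_space
    by (auto simp: subspace_def blinfun.add_left blinfun.scaleR_left)
  then obtain G where G: "finite G" "W \<subseteq> span ({f \<in> W. \<forall>v\<in>F. blinfun_apply f v = 0} \<union> G)"
    using finite_codim_annihilator[OF F(1)] by blast
  have "f = 0" if f: "f \<in> W" "\<forall>v\<in>F. blinfun_apply f v = 0" for f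
  proof (rule blinfun_eqI)
    fix x
    have l: "linear (blinfun_apply f)" by (simp add: bounded_linear.linear blinfun.bounded_linear_right)
    show "blinfun_apply f x = blinfun_apply 0 x"
      using linear_eq_0_on_span[OF l, of "R \<union> F" x] f F(2) by (auto simp: W_def)
  qed
  then have "span ({f \<in> W. \<forall>v\<in>F. blinfun_apply f v = 0} \<union> G) \<subseteq> span (insert 0 G)"
    by (intro span_mono) auto
  then have "W \<subseteq> span G" using G(2) by simp
  then show ?thesis using G(1) by (auto simp: W_def)
qed

text \<open>The kernel splits into that of \<open>A ^^ n\<close> and the functionals that annihilate
  the range of \<open>A ^^ n\<close>.\<close>

lemma fin_dim_kernel_adj_sum:
  fixes A :: "'a::cbanach \<Rightarrow> 'a"
  assumes A: "clinear_op A" and fr: "fredholm A"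
  shows "fin_dim dsum_scale (kernel_on dsum_space (adj_sum A ^^ n))"
proof -
  have bA: "bounded_linear A" using A by (simp add: clinear_op_def)
  obtain F where F: "finite F" "kernel_on UNIV (A ^^ n) \<subseteq> span F" using fredholm_funpow(1)[OF A fr] by blast
  obtain H where "finite H" "span (range (A ^^ n) \<union> H) = UNIV" using fredholm_funpow(2)[OF A fr] by blast
  then obtain G where G: "finite G" "{f \<in> dual_space. \<forall>x\<in>range (A ^^ n). blinfun_apply f x = 0} \<subseteq> span G"
    using finite_dim_annihilator by blast
  have "kernel_on dsum_space (adj_sum A ^^ n) \<subseteq> span (F \<times> {0} \<union> {0} \<times> G)"
  proof
    fix y assume y: "y \<in> kernel_on dsum_space (adj_sum A ^^ n)"
    then have "fst y \<in> span F" using F(2) by (auto simp: kernel_on_def adj_sum_funpow zero_prod_def)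
    moreover have "snd y \<in> span G"
    proof -
      have "snd y \<in> dual_space" "(adj A ^^ n) (snd y) = 0"
        using y by (auto simp: kernel_on_def adj_sum_funpow zero_prod_def dsum_space_def)
      moreover from this(2) have "blinfun_apply (snd y) ((A ^^ n) x) = 0" for x
        by (metis adj_funpow_apply[OF bA] zero_blinfun.rep_eq)
      ultimately show ?thesis using G(2) by auto
    qed
    moreover have "(\<lambda>x. (x, 0)) ` span F \<subseteq> span (F \<times> {0} \<union> {0} \<times> G)"
    proof -
      have "linear (\<lambda>x. (x, 0 :: 'a \<Rightarrow>\<^sub>L complex))" by (rule linearI) auto
      then have "(\<lambda>x. (x, 0 :: 'a \<Rightarrow>\<^sub>L complex)) ` span F = span ((\<lambda>x. (x, 0)) ` F)" by (rule linear_span_image[symmetric])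
      also have "\<dots> \<subseteq> span (F \<times> {0} \<union> {0} \<times> G)" by (intro span_mono) auto
      finally show ?thesis .
    qed
    moreover have "(\<lambda>f. (0, f)) ` span G \<subseteq> span (F \<times> {0} \<union> {0} \<times> G)"
    proof -
      have "linear (\<lambda>f. (0 :: 'a, f :: 'a \<Rightarrow>\<^sub>L complex))" by (rule linearI) auto
      then have "(\<lambda>f. (0 :: 'a, f)) ` span G = span ((\<lambda>f. (0, f)) ` G)" by (rule linear_span_image[symmetric])
      also have "\<dots> \<subseteq> span (F \<times> {0} \<union> {0} \<times> G)" by (intro span_mono) auto
      finally show ?thesis .
    qed
    ultimately have "(fst y, 0) + (0, snd y) \<in> span (F \<times> {0} \<union> {0} \<times> G)" by (intro span_add) auto
    then show "y \<in> span (F \<times> {0} \<union> {0} \<times> G)" by simp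
  qed
  moreover have "finite (F \<times> {0 :: 'a \<Rightarrow>\<^sub>L complex} \<union> {0 :: 'a} \<times> G)" using F(1) G(1) by simp
  ultimately show ?thesis by (intro fin_dim_if_span[of dsum_scale, OF dsum_scale_of_real])
qed

lemma closed_H0_adj_sum_if_fin_dim:
  assumes A: "clinear_op A" and fd: "fin_dim dsum_scale (H0 dsum_space (adj_sum A))"
  shows "closed (H0 dsum_space (adj_sum A))"
proof -
  have "linear (adj_sum A)"
    using A bounded_linear_adj_sum by (auto simp: clinear_op_def intro: bounded_linear.linear)
  then have "subspace (H0 dsum_space (adj_sum A))" by (rule subspace_H0[OF subspace_dsum_space])
  moreover obtain F where "finite F" "H0 dsum_space (adj_sum A) \<subseteq> span F"
    by (rule fin_dim_imp_span[of dsum_scale, OF dsum_scale_Re_Im fd])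
  ultimately show ?thesis using closed_subspace_finite_dim by blast
qed

text \<open>Closed \<open>H0\<close> gives finite ascent of \<open>A\<close> and of
  \<open>adj A\<close>. If a vector in the range of \<open>A ^^ n\<close> were outside the closed
  range of \<open>A ^^ Suc n\<close>, a separating functional would lie in the kernel of
  \<open>adj A ^^ Suc n\<close> but not of \<open>adj A ^^ n\<close>.\<close>

lemma finite_ascent_descent_if_closed_H0:
  fixes A :: "'a::cbanach \<Rightarrow> 'a"
  assumes A: "clinear_op A" and fr: "fredholm A" and cl: "closed (H0 dsum_space (adj_sum A))"
  shows "finite_ascent A" "finite_descent A"
proof -
  have bA: "bounded_linear A" using A by (simp add: clinear_op_def)
  then have lA: "linear A" by (simp add: bounded_linear.linear)
  have lin: "linear (A ^^ n)" for n using bounded_linear_funpow[OF bA] bounded_linear.linear by blast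
  have cH: "closed (H0 UNIV A)" "closed (H0 dual_space (adj A))"
    unfolding H0_eq_vimage_adj_sum[OF lA] by (intro closed_vimage cl continuous_intros)+
  obtain K where K: "finite K" "kernel_on UNIV A \<subseteq> span K" using fredholm_funpow(1)[OF A fr, of 1] by auto
  show "finite_ascent A" unfolding finite_ascent_def
    by (rule finite_ascent_if_closed_H0[OF bA subspace_UNIV _ cH(1) K]) (use fredholm_funpow(3)[OF A fr] in auto)
  obtain H where "finite H" "span (range A \<union> H) = UNIV" using fredholm_funpow(2)[OF A fr, of 1] by auto
  then obtain G where G: "finite G" "{f \<in> dual_space. \<forall>x\<in>range A. blinfun_apply f x = 0} \<subseteq> span G"
    using finite_dim_annihilator by blast
  have "kernel_on dual_space (adj A) \<subseteq> {f \<in> dual_space. \<forall>x\<in>range A. blinfun_apply f x = 0}"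
  proof
    fix f assume "f \<in> kernel_on dual_space (adj A)"
    then have f: "f \<in> dual_space" "adj A f = 0" by (auto simp: kernel_on_def)
    have "blinfun_apply f (A x) = 0" for x using f(2) by (metis adj_apply[OF bA] zero_blinfun.rep_eq)
    then show "f \<in> {f \<in> dual_space. \<forall>x\<in>range A. blinfun_apply f x = 0}" using f(1) by auto
  qed
  then have ker: "kernel_on dual_space (adj A) \<subseteq> span G" using G(2) by blast
  have clr: "closed ((adj A ^^ n) ` dual_space)" for n
    using closed_annihilator[of "{x. (A ^^ n) x = 0}"]
    unfolding adj_range_eq_annihilator[OF A fredholm_funpow(3)[OF A fr]] by simp
  have "\<exists>n. kernel_on dual_space (adj A ^^ n) = kernel_on dual_space (adj A ^^ Suc n)"
    by (rule finite_ascent_if_closed_H0[OF bounded_linear_adj subspace_dual_space _ cH(2) G(1) ker clr])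
      (use adj_mem_dual_space[OF A] in auto)
  then obtain n where n: "kernel_on dual_space (adj A ^^ n) = kernel_on dual_space (adj A ^^ Suc n)" by blast
  have "range (A ^^ n) \<subseteq> range (A ^^ Suc n)"
  proof (rule ccontr)
    assume "\<not> ?thesis"
    then obtain u where u: "(A ^^ n) u \<notin> range (A ^^ Suc n)" by blast
    have "(A ^^ Suc n) (cscale \<i> x) = cscale \<i> ((A ^^ Suc n) x)" for x
      using clinear_op_funpow[OF A, of "Suc n"] unfolding clinear_op_def by blast
    then have ci: "cscale \<i> x \<in> range (A ^^ Suc n)" if "x \<in> range (A ^^ Suc n)" for x
      using that by (metis (no_types, lifting) imageE rangeI)
    obtain g where g: "g \<in> dual_space" "\<And>x. x \<in> range (A ^^ Suc n) \<Longrightarrow> blinfun_apply g x = 0"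
      "blinfun_apply g ((A ^^ n) u) \<noteq> 0"
      using dual_separation[OF fredholm_funpow(3)[OF A fr] linear_subspace_image[OF lin subspace_UNIV] ci u] by blast
    have "(adj A ^^ Suc n) g = 0"
    proof (rule blinfun_eqI)
      show "blinfun_apply ((adj A ^^ Suc n) g) x = blinfun_apply 0 x" for x
        unfolding adj_funpow_apply[OF bA] using g(2) by simp
    qed
    then have "g \<in> kernel_on dual_space (adj A ^^ n)" unfolding n using g(1) by (simp add: kernel_on_def)
    then have "(adj A ^^ n) g = 0" by (simp add: kernel_on_def)
    then show False using g(3) by (metis adj_funpow_apply[OF bA] zero_blinfun.rep_eq)
  qed
  moreover have "range (A ^^ Suc n) \<subseteq> range (A ^^ n)" by (auto simp: funpow_swap1)
  ultimately show "finite_descent A" unfolding finite_descent_def by blast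
qed

lemma fin_codim_Kcore_adj_sum:
  fixes A :: "'a::cbanach \<Rightarrow> 'a"
  assumes A: "clinear_op A" and fr: "fredholm A" and fin: "finite_ascent A" "finite_descent A"
  shows "fin_codim dsum_scale dsum_space (Kcore dsum_space (adj_sum A))"
proof -
  have bA: "bounded_linear A" using A by (simp add: clinear_op_def)
  then have lA: "linear A" by (simp add: bounded_linear.linear)
  have lin: "linear (A ^^ n)" for n using bounded_linear_funpow[OF bA] bounded_linear.linear by blast
  obtain n where n: "ascent A \<le> n" "A ` range (A ^^ n) = range (A ^^ n)"
    and ker: "\<And>m. ascent A \<le> m \<Longrightarrow> kernel_on UNIV (A ^^ m) = kernel_on UNIV (A ^^ ascent A)"
    using ascent_descent_decomposition[OF lA fin] by metis
  define N where "N = kernel_on UNIV (A ^^ n)"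
  define P where "P = {f :: 'a \<Rightarrow>\<^sub>L complex. f \<in> dual_space \<and> (\<forall>x\<in>N. blinfun_apply f x = 0)}"
  \<comment> \<open>The stable range times the annihilator of the stable kernel: closed, of finite
    codimension and mapped onto itself, hence inside the analytic core.\<close>
  define Q where "Q = range (A ^^ n) \<times> P"
  have ann: "(adj A ^^ m) ` dual_space = P" if m: "n \<le> m" for m
  proof -
    have "N = kernel_on UNIV (A ^^ m)" unfolding N_def using ker[of n] ker[of m] n(1) m by simp
    then show ?thesis
      unfolding adj_range_eq_annihilator[OF A fredholm_funpow(3)[OF A fr]] P_def kernel_on_def by auto
  qed
  have "adj A ` P = (adj A ^^ Suc n) ` dual_space" unfolding ann[OF order_refl, symmetric] by (auto simp: image_image)
  then have adjP: "adj A ` P = P" using ann[of "Suc n"] by simp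
  have sP: "subspace P" unfolding P_def using subspace_dual_space
    by (auto simp: subspace_def blinfun.add_left blinfun.scaleR_left)
  have "Q \<subseteq> Kcore dsum_space (adj_sum A)"
  proof (rule invariant_subset_Kcore[OF bounded_linear_adj_sum[OF bA]])
    show "closed Q" unfolding Q_def P_def
      by (intro closed_Times fredholm_funpow(3)[OF A fr] closed_annihilator)
    show "subspace Q" unfolding Q_def
      by (intro subspace_Times sP linear_subspace_image[OF lin subspace_UNIV])
    have "adj_sum A ` Q = (A ` range (A ^^ n)) \<times> (adj A ` P)" unfolding Q_def adj_sum_def by force
    then show "adj_sum A ` Q = Q" unfolding n(2) adjP by (simp add: Q_def)
    show "Q \<subseteq> dsum_space" by (auto simp: Q_def P_def dsum_space_def)
  qed
  obtain F where F: "finite F" "span (range (A ^^ n) \<union> F) = UNIV" using fredholm_funpow(2)[OF A fr] by blast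
  obtain K where K: "finite K" "N \<subseteq> span K" unfolding N_def using fredholm_funpow(1)[OF A fr] by blast
  obtain G where G: "finite G" "G \<subseteq> dual_space" "dual_space \<subseteq> span ({f \<in> dual_space. \<forall>v\<in>K. blinfun_apply f v = 0} \<union> G)"
    using finite_codim_annihilator[OF K(1) subspace_dual_space] by blast
  have "{f \<in> dual_space. \<forall>v\<in>K. blinfun_apply f v = 0} \<subseteq> P"
  proof
    fix f assume f: "f \<in> {f \<in> dual_space. \<forall>v\<in>K. blinfun_apply f v = 0}"
    have l: "linear (blinfun_apply f)" by (simp add: bounded_linear.linear blinfun.bounded_linear_right)
    have "blinfun_apply f x = 0" if "x \<in> N" for x
      using linear_eq_0_on_span[OF l, of K x] f that K(2) by auto
    then show "f \<in> P" using f by (simp add: P_def)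
  qed
  then have dP: "dual_space \<subseteq> span (P \<union> G)"
    using G(3) span_mono[of "{f \<in> dual_space. \<forall>v\<in>K. blinfun_apply f v = 0} \<union> G" "P \<union> G"] by auto
  let ?B = "F \<times> {0} \<union> {0} \<times> G"
  have zero: "0 \<in> P" "0 \<in> range (A ^^ n)"
    using subspace_0[OF sP] subspace_0[OF linear_subspace_image[OF lin subspace_UNIV]] by blast+
  have "dsum_space \<subseteq> span (Q \<union> ?B)"
  proof
    fix y :: "'a \<times> ('a \<Rightarrow>\<^sub>L complex)" assume y: "y \<in> dsum_space"
    have "(\<lambda>x. (x, 0 :: 'a \<Rightarrow>\<^sub>L complex)) ` span (range (A ^^ n) \<union> F) \<subseteq> span (Q \<union> ?B)"
    proof -
      have "linear (\<lambda>x. (x :: 'a, 0 :: 'a \<Rightarrow>\<^sub>L complex))" by (rule linearI) auto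
      then have "(\<lambda>x. (x, 0 :: 'a \<Rightarrow>\<^sub>L complex)) ` span (range (A ^^ n) \<union> F) = span ((\<lambda>x. (x, 0)) ` (range (A ^^ n) \<union> F))"
        by (rule linear_span_image[symmetric])
      also have "\<dots> \<subseteq> span (Q \<union> ?B)" using zero by (intro span_mono) (auto simp: Q_def)
      finally show ?thesis .
    qed
    then have 1: "(fst y, 0) \<in> span (Q \<union> ?B)" unfolding F(2) by blast
    have "(\<lambda>f. (0 :: 'a, f)) ` span (P \<union> G) \<subseteq> span (Q \<union> ?B)"
    proof -
      have "linear (\<lambda>f. (0 :: 'a, f :: 'a \<Rightarrow>\<^sub>L complex))" by (rule linearI) auto
      then have "(\<lambda>f. (0 :: 'a, f)) ` span (P \<union> G) = span ((\<lambda>f. (0, f)) ` (P \<union> G))"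
        by (rule linear_span_image[symmetric])
      also have "\<dots> \<subseteq> span (Q \<union> ?B)" using zero by (intro span_mono) (auto simp: Q_def)
      finally show ?thesis .
    qed
    moreover have "snd y \<in> span (P \<union> G)" using y dP by (auto simp: dsum_space_def)
    ultimately have 2: "(0, snd y) \<in> span (Q \<union> ?B)" by blast
    show "y \<in> span (Q \<union> ?B)" using span_add[OF 1 2] by simp
  qed
  moreover have "?B \<subseteq> dsum_space"
    using G(2) subspace_0[OF subspace_dual_space] by (auto simp: dsum_space_def)
  moreover have "finite ?B" using F(1) G(1) by simp
  ultimately show ?thesis
    using \<open>Q \<subseteq> Kcore dsum_space (adj_sum A)\<close> by (intro fin_codim_if_span[of dsum_scale, OF dsum_scale_of_real])
qed

text \<open>The analytic core lies in the range of every power, so these ranges have bounded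
  codimension and become stationary. In the first component this is finite descent of
  \<open>A\<close>; in the second it gives finite ascent, since every functional composed with
  \<open>A ^^ n\<close> factors through \<open>A ^^ Suc n\<close>.\<close>

lemma finite_ascent_descent_if_fin_codim_Kcore:
  fixes A :: "'a::cbanach \<Rightarrow> 'a"
  assumes A: "clinear_op A" and cod: "fin_codim dsum_scale dsum_space (Kcore dsum_space (adj_sum A))"
  shows "finite_ascent A" "finite_descent A"
proof -
  have bA: "bounded_linear A" using A by (simp add: clinear_op_def)
  then have lA: "linear A" by (simp add: bounded_linear.linear)
  define R where "R k = (adj_sum A ^^ k) ` dsum_space" for k
  have Rprod: "R k = range (A ^^ k) \<times> (adj A ^^ k) ` dual_space" for k
    unfolding R_def dsum_space_def adj_sum_funpow by force
  have lS: "linear (adj_sum A ^^ k)" for k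
    using bounded_linear_funpow[OF bounded_linear_adj_sum[OF bA]] bounded_linear.linear by blast
  obtain F where F: "finite F" "\<And>R. Kcore dsum_space (adj_sum A) \<subseteq> R \<Longrightarrow> dsum_scale \<i> ` R \<subseteq> R \<Longrightarrow> dsum_space \<subseteq> span (R \<union> F)"
    using fin_codim_imp_span[of dsum_scale, OF dsum_scale_Re_Im cod] by metis
  have Ri: "dsum_scale \<i> ` R k \<subseteq> R k" for k
  proof
    fix y assume "y \<in> dsum_scale \<i> ` R k"
    then obtain x f where xf: "f \<in> dual_space" "y = dsum_scale \<i> ((A ^^ k) x, (adj A ^^ k) f)"
      by (auto simp: Rprod)
    have "cscale \<i> ((A ^^ k) x) = (A ^^ k) (cscale \<i> x)"
      using clinear_op_funpow[OF A, of k] by (simp add: clinear_op_def)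
    moreover have "dual_scale \<i> ((adj A ^^ k) f) = (adj A ^^ k) (dual_scale \<i> f)"
      by (rule blinfun_eqI) (simp add: dual_scale_apply adj_funpow_apply[OF bA])
    moreover have "dual_scale \<i> f \<in> dual_space"
      using xf(1) by (auto simp: dual_space_def dual_scale_apply)
    ultimately show "y \<in> R k" unfolding Rprod xf(2) dsum_scale_def by simp
  qed
  obtain n where n: "\<And>m. n \<le> m \<Longrightarrow> R m = R n"
  proof (rule antitone_finite_codim_stable[of R dsum_space F])
    show "subspace (R k)" for k unfolding R_def using linear_subspace_image[OF lS subspace_dsum_space] .
    have R1: "R (Suc k) \<subseteq> R k" for k
      unfolding R_def using adj_sum_mem_dsum_space[OF A] by (auto simp: funpow_swap1)
    then show "antimono R" by (simp add: antimono_iff_le_Suc)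
    show "R k \<subseteq> dsum_space" for k
      unfolding R_def using funpow_cong_on[of dsum_space "adj_sum A" "adj_sum A"] adj_sum_mem_dsum_space[OF A] by auto
    show "dsum_space \<subseteq> span (R k \<union> F)" for k
      using F(2)[of "R k"] Ri Kcore_subset_range unfolding R_def by blast
  qed (use F in auto)
  \<comment> \<open>Equality of products yields equality of the factors only if these are
    nonempty.\<close>
  have zd: "0 \<in> dual_space" using subspace_0[OF subspace_dual_space] .
  have "R n = R (Suc n)" using n[of "Suc n"] by simp
  then have eq: "range (A ^^ n) = range (A ^^ Suc n)" "(adj A ^^ n) ` dual_space = (adj A ^^ Suc n) ` dual_space"
    using zd unfolding Rprod times_eq_iff by blast+
  show "finite_descent A" unfolding finite_descent_def using eq(1) by blast
  have "(A ^^ n) x = 0" if x: "(A ^^ Suc n) x = 0" for x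
  proof (rule ccontr)
    assume "(A ^^ n) x \<noteq> 0"
    then obtain g where g: "g \<in> dual_space" "blinfun_apply g ((A ^^ n) x) \<noteq> 0"
      using dual_separation[of "{0}" "(A ^^ n) x"] cscale_zero by auto
    have "(adj A ^^ n) g \<in> (adj A ^^ Suc n) ` dual_space" using g(1) eq(2) by blast
    then obtain g' where "(adj A ^^ n) g = (adj A ^^ Suc n) g'" by blast
    then have "blinfun_apply g ((A ^^ n) x) = blinfun_apply g' ((A ^^ Suc n) x)"
      by (metis adj_funpow_apply[OF bA])
    then show False using g(2) x by (simp add: blinfun.zero_right)
  qed
  moreover have "(A ^^ Suc n) x = 0" if "(A ^^ n) x = 0" for x using that by (simp add: linear_0[OF lA])
  ultimately have "kernel_on UNIV (A ^^ n) = kernel_on UNIV (A ^^ Suc n)"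
    unfolding kernel_on_def by blast
  then show "finite_ascent A" unfolding finite_ascent_def by blast
qed

text \<open>The space is the sum of the finite-dimensional kernel of \<open>A ^^ n\<close> and a
  subspace of the range of \<open>A\<close>, so this range has finite codimension and is closed.
  This yields the inclusion of \<open>Pi0 T\<close> in \<open>Delta_e T\<close>.\<close>

lemma fredholm_if_finite_ascent_descent:
  fixes A :: "'a::cbanach \<Rightarrow> 'a"
  assumes A: "clinear_op A" and fin: "finite_ascent A" "finite_descent A"
    and fd: "fin_dim cscale (kernel_on UNIV A)"
  shows "fredholm A"
proof -
  have bA: "bounded_linear A" using A by (simp add: clinear_op_def)
  then have lA: "linear A" by (simp add: bounded_linear.linear)
  obtain n where n: "n > 0" and dec: "\<And>x. \<exists>z. (A ^^ n) (x - (A ^^ n) z) = 0"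
    using ascent_descent_decomposition[OF lA fin] by metis
  obtain K where K: "finite K" "kernel_on UNIV A \<subseteq> span K"
    by (rule fin_dim_imp_span[of cscale, OF cscale_Re_Im fd])
  obtain F where F: "finite F" "kernel_on UNIV (A ^^ n) \<subseteq> span F"
    using finite_dim_kernel_funpow[OF lA K] by blast
  have "x \<in> span (range A \<union> F)" for x
  proof -
    obtain z where z: "(A ^^ n) (x - (A ^^ n) z) = 0" using dec by blast
    obtain m where m: "n = Suc m" using n by (cases n) auto
    have 1: "(A ^^ n) z \<in> span (range A \<union> F)" unfolding m by (intro span_base) simp
    have "x - (A ^^ n) z \<in> span F" using F(2) z by (auto simp: kernel_on_def)
    then have "x - (A ^^ n) z \<in> span (range A \<union> F)" using span_mono[of F "range A \<union> F"] by blast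
    from span_add[OF this 1] show ?thesis by simp
  qed
  then have sp: "span (range A \<union> F) = UNIV" by blast
  then have "closed (range A)" by (rule closed_range_finite_codim[OF bA F(1)])
  moreover have "fin_codim cscale UNIV (range A)"
    by (rule fin_codim_if_span[of cscale F UNIV "range A", OF cscale_of_real F(1)]) (use sp in auto)
  ultimately show ?thesis using fd by (simp add: fredholm_def)
qed

theorem theorem2p15:
  fixes T :: "'a::cbanach \<Rightarrow>\<^sub>L 'a"
  assumes inf_dim: "\<not> fin_dim cscale (UNIV :: 'a set)"
    and T_clinear: "\<forall>c x. blinfun_apply T (cscale c x) = cscale c (blinfun_apply T x)"
  shows "(class_Be T
      \<longleftrightarrow> (\<forall>\<mu>\<in>Delta_e T. finite_ascent (shift T \<mu>) \<and>
            H0 dsum_space (dsum_shift T \<mu>)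
              = kernel_on dsum_space ((dsum_shift T \<mu>) ^^ ascent (shift T \<mu>))))
    \<and> (class_Be T \<longleftrightarrow> (\<forall>\<mu>\<in>Delta_e T. fin_dim dsum_scale (H0 dsum_space (dsum_shift T \<mu>))))
    \<and> (class_Be T \<longleftrightarrow> (\<forall>\<mu>\<in>Delta_e T. closed (H0 dsum_space (dsum_shift T \<mu>))))
    \<and> (class_Be T \<longleftrightarrow> (\<forall>\<mu>\<in>Delta_e T.
            fin_codim dsum_scale dsum_space (Kcore dsum_space (dsum_shift T \<mu>))))"
proof -
  note cl = clinear_op_shift[OF T_clinear]
  have ag: "dsum_shift T \<mu> y = adj_sum (shift T \<mu>) y \<and> adj_sum (shift T \<mu>) y \<in> dsum_space"
    if "y \<in> dsum_space" for \<mu> y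
    using dsum_shift_eq_adj_sum[OF T_clinear that] adj_sum_mem_dsum_space[OF cl that] by simp
  have cong: "H0 dsum_space (dsum_shift T \<mu>) = H0 dsum_space (adj_sum (shift T \<mu>))"
    "kernel_on dsum_space (dsum_shift T \<mu> ^^ n) = kernel_on dsum_space (adj_sum (shift T \<mu>) ^^ n)"
    "Kcore dsum_space (dsum_shift T \<mu>) = Kcore dsum_space (adj_sum (shift T \<mu>))" for \<mu> n
    by (rule H0_kernel_Kcore_cong, erule ag)+
  have fr: "fredholm (shift T \<mu>)" if "\<mu> \<in> Delta_e T" for \<mu>
    using that by (auto simp: Delta_e_def ess_spectrum_def)
  have "Pi0 T \<subseteq> Delta_e T"
    using fredholm_if_finite_ascent_descent[OF cl] by (auto simp: Pi0_def Delta_e_def ess_spectrum_def)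
  \<comment> \<open>Since the other inclusion always holds, \<open>class_Be T\<close> reduces to a
    condition on each point of \<open>Delta_e T\<close> separately.\<close>
  moreover have "Delta_e T \<subseteq> Pi0 T
      \<longleftrightarrow> (\<forall>\<mu>\<in>Delta_e T. finite_ascent (shift T \<mu>) \<and> finite_descent (shift T \<mu>))"
    using fr by (auto simp: Pi0_def Delta_e_def fredholm_def)
  ultimately have Be: "class_Be T
      \<longleftrightarrow> (\<forall>\<mu>\<in>Delta_e T. finite_ascent (shift T \<mu>) \<and> finite_descent (shift T \<mu>))"
    by (auto simp: class_Be_def)
  let ?fin = "\<lambda>\<mu>. finite_ascent (shift T \<mu>) \<and> finite_descent (shift T \<mu>)"
  let ?H = "\<lambda>\<mu>. H0 dsum_space (adj_sum (shift T \<mu>))"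
  let ?N = "\<lambda>\<mu>. kernel_on dsum_space (adj_sum (shift T \<mu>) ^^ ascent (shift T \<mu>))"
  let ?K = "\<lambda>\<mu>. fin_codim dsum_scale dsum_space (Kcore dsum_space (adj_sum (shift T \<mu>)))"
  \<comment> \<open>At a fixed point the conditions form the cycle \<open>?fin\<close>,
    \<open>?H = ?N\<close>, finite dimension, closedness, \<open>?fin\<close>; the condition
    \<open>?K\<close> is tied to \<open>?fin\<close> directly.\<close>
  have "(?fin \<mu> \<longleftrightarrow> finite_ascent (shift T \<mu>) \<and> ?H \<mu> = ?N \<mu>) \<and> (?fin \<mu> \<longleftrightarrow> fin_dim dsum_scale (?H \<mu>))
      \<and> (?fin \<mu> \<longleftrightarrow> closed (?H \<mu>)) \<and> (?fin \<mu> \<longleftrightarrow> ?K \<mu>)" if \<mu>: "\<mu> \<in> Delta_e T" for \<mu>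
  proof -
    have "?fin \<mu> \<Longrightarrow> ?H \<mu> = ?N \<mu>" using H0_adj_sum_eq_kernel[OF cl fr[OF \<mu>]] by blast
    moreover have "?H \<mu> = ?N \<mu> \<Longrightarrow> fin_dim dsum_scale (?H \<mu>)"
      using fin_dim_kernel_adj_sum[OF cl fr[OF \<mu>], of "ascent (shift T \<mu>)"] by simp
    moreover have "fin_dim dsum_scale (?H \<mu>) \<Longrightarrow> closed (?H \<mu>)"
      by (rule closed_H0_adj_sum_if_fin_dim[OF cl])
    moreover have "closed (?H \<mu>) \<Longrightarrow> ?fin \<mu>"
      using finite_ascent_descent_if_closed_H0[OF cl fr[OF \<mu>]] by blast
    moreover have "?fin \<mu> \<Longrightarrow> ?K \<mu>" using fin_codim_Kcore_adj_sum[OF cl fr[OF \<mu>]] by blast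
    moreover have "?K \<mu> \<Longrightarrow> ?fin \<mu>" using finite_ascent_descent_if_fin_codim_Kcore[OF cl] by blast
    ultimately show ?thesis by blast
  qed
  then show ?thesis unfolding Be cong by blast
qed

end
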